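(* Let $m\ge 1$, $n\ge 2$ be integers, let $\varsigma_2,\varsigma_4,\dots,\varsigma_{2m-2}\in\mathbb{Z}[q,q^{-1}]$ be nonzero, and set $\kappa_1=1$, $\kappa_i=\prod_{j=1}^{i-1}(-\varsigma_{2j})$ for $2\le i\le m$. Let $\mathbb{W}=\bigoplus_{i=1}^{2m}\mathbb{Q}(q)v_i$. Then there is a right action of $\mathfrak{B}_n(-q^{-1},q^{2m})$ on $\mathbb{W}^{\otimes n}$ given, for $1\le k\le n-1$, by $$(v_{a_1}\otimes\cdots\otimes v_{a_n})\cdot H_k=\begin{cases} q\,v_{a_1}\otimes\cdots\otimes v_{a_n} & \text{if } a_k=a_{k+1},\\ \cdots\otimes v_{a_{k+1}}\otimes v_{a_k}\otimes\cdots & \text{if } a_k>a_{k+1},\\ \cdots\otimes v_{a_{k+1}}\otimes v_{a_k}\otimes\cdots+(q-q^{-1})v_{a_1}\otimes\cdots\otimes v_{a_n} & \text{if } a_k<a_{k+1},\end{cases}$$ (where $\cdots\otimes v_{a_{k+1}}\otimes v_{a_k}\otimes\cdots$ denotes $v_{a_1}\otimes\cdots\otimes v_{a_n}$ with the $k$-th and $(k+1)$-st factors interchanged), and by letting $(v_{a_1}\otimes v_{a_2}\otimes\cdots\otimes v_{a_n})\cdot e$ be equal to - $\sum_{j=1}^m\kappa_i\kappa_j^{-1}q^{2m+1-3i-j}(v_{2j-1}\otimes v_{2j}-q\,v_{2j}\otimes v_{2j-1})\otimes v_{a_3}\otimes\cdots\otimes v_{a_n}$ if $a_1=2i-1$,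 $a_2=2i$ for some $1\le i\le m$; - $(-q)\,(v_{a_2}\otimes v_{a_1}\otimes v_{a_3}\otimes\cdots\otimes v_{a_n})\cdot e$ if $a_1=2i$, $a_2=2i-1$ for some $1\le i\le m$; - $0$ otherwise.
   Context: For invertible parameters $x,z$, the $q$-Brauer algebra $\mathfrak{B}_n(x,z)$ is the unital associative algebra with generators $H_1,\dots,H_{n-1},e$ and relations (each imposed whenever the generators in it exist): $(H_i-x)(H_i+x^{-1})=0$; $H_iH_{i+1}H_i=H_{i+1}H_iH_{i+1}$; $H_iH_j=H_jH_i$ for $|i-j|>1$; $e^2=\frac{z-z^{-1}}{x-x^{-1}}e$; $H_1e=eH_1=xe$; $eH_2e=ze$; $H_ie=eH_i$ for $i>2$; $H_2H_3H_1^{-1}H_2^{-1}e_{(2)}=e_{(2)}=e_{(2)}H_2H_3H_1^{-1}H_2^{-1}$, where $e_{(2)}=e(H_2H_3H_1^{-1}H_2^{-1})e$. $\mathfrak{B}_n(-q^{-1},q^{2m})$ is this algebra over $\mathbb{Q}(q)$ with $x=-q^{-1}$ and $z=q^{2m}$. *)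

theory Defs
  imports
    "HOL-Library.Poly_Mapping"
    "HOL-Computational_Algebra.Polynomial"
    "HOL-Computational_Algebra.Fraction_Field"
    "HOL-Algebra.QuotRing"
    "HOL-Algebra.Module"
begin

section \<open>Free algebras on a set of generators\<close>

text \<open>
  Words over an alphabet form a monoid under concatenation, written additively because
  \<^theory>\<open>HOL-Library.Poly_Mapping\<close> builds the convolution product from \<open>+\<close> on
  the keys. Finitely supported functions on words with this product are the noncommutative
  polynomials.
\<close>

datatype 'g word = Word "'g list"

primrec letters :: "'g word \<Rightarrow> 'g list" where
  "letters (Word u) = u"

instantiation word :: (type) monoid_add
begin

definition zero_word :: "'a word" where "0 = Word []"

definition plus_word :: "'a word \<Rightarrow> 'a word \<Rightarrow> 'a word" where
  "u + v = Word (letters u @ letters v)"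

instance
proof
  fix u v w :: "'a word"
  show "u + v + w = u + (v + w)" by (simp add: plus_word_def)
  show "0 + u = u" by (cases u) (simp add: plus_word_def zero_word_def)
  show "u + 0 = u" by (cases u) (simp add: plus_word_def zero_word_def)
qed

end

definition scale :: "'k::field \<Rightarrow> ('i \<Rightarrow>\<^sub>0 'k) \<Rightarrow> ('i \<Rightarrow>\<^sub>0 'k)" where
  "scale c f = Poly_Mapping.map ((*) c) f"

abbreviation scalar :: "'k::field \<Rightarrow> ('g word \<Rightarrow>\<^sub>0 'k)" where
  "scalar c \<equiv> Poly_Mapping.single 0 c"

abbreviation generator :: "'g \<Rightarrow> ('g word \<Rightarrow>\<^sub>0 'k::field)" where
  "generator g \<equiv> Poly_Mapping.single (Word [g]) 1"

definition free_algebra :: "'g set \<Rightarrow> ('k::field, 'g word \<Rightarrow>\<^sub>0 'k) module" where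
  "free_algebra G =
    \<lparr>carrier = {f. \<forall>w\<in>Poly_Mapping.keys f. set (letters w) \<subseteq> G},
     mult = (*), one = 1, zero = 0, add = (+), smult = scale\<rparr>"

text \<open>The algebra with generators \<open>G\<close> and relations \<open>l = r\<close> for \<open>(l, r) \<in> R\<close>:
  the quotient of the free algebra by the two-sided ideal generated by all \<open>l - r\<close>.\<close>

definition relation_ideal ::
    "'g set \<Rightarrow> (('g word \<Rightarrow>\<^sub>0 'k) \<times> ('g word \<Rightarrow>\<^sub>0 'k)) set \<Rightarrow> ('g word \<Rightarrow>\<^sub>0 'k::field) set" where
  "relation_ideal G R = genideal (free_algebra G) {l - r | l r. (l, r) \<in> R}"

definition presented_class ::
    "'g set \<Rightarrow> (('g word \<Rightarrow>\<^sub>0 'k) \<times> ('g word \<Rightarrow>\<^sub>0 'k)) set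
      \<Rightarrow> ('g word \<Rightarrow>\<^sub>0 'k::field) \<Rightarrow> ('g word \<Rightarrow>\<^sub>0 'k) set" where
  "presented_class G R f = relation_ideal G R +>\<^bsub>free_algebra G\<^esub> f"

definition presented_algebra ::
    "'g set \<Rightarrow> (('g word \<Rightarrow>\<^sub>0 'k) \<times> ('g word \<Rightarrow>\<^sub>0 'k)) set
      \<Rightarrow> ('k::field, ('g word \<Rightarrow>\<^sub>0 'k) set) module" where
  "presented_algebra G R =
    ring.extend (free_algebra G Quot relation_ideal G R)
      \<lparr>smult = (\<lambda>c X. \<Union>f\<in>X. presented_class G R (scale c f))\<rparr>"


section \<open>Right actions of an algebra on a vector space\<close>

text \<open>\<open>V\<close> is a subset of an ambient vector space with scalar multiplication \<open>sc\<close>;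
  nothing is required of \<open>act\<close> outside \<open>V\<close> and \<open>carrier A\<close>.\<close>

locale right_action =
  fixes A :: "('k::field, 'a, 'x) module_scheme" (structure)
    and V :: "'v::ab_group_add set"
    and sc :: "'k \<Rightarrow> 'v \<Rightarrow> 'v"
    and act :: "'v \<Rightarrow> 'a \<Rightarrow> 'v"
  assumes act_closed: "v \<in> V \<Longrightarrow> a \<in> carrier A \<Longrightarrow> act v a \<in> V"
    and act_add_left: "v \<in> V \<Longrightarrow> w \<in> V \<Longrightarrow> a \<in> carrier A \<Longrightarrow> act (v + w) a = act v a + act w a"
    and act_scale_left: "v \<in> V \<Longrightarrow> a \<in> carrier A \<Longrightarrow> act (sc c v) a = sc c (act v a)"
    and act_add_right:
      "v \<in> V \<Longrightarrow> a \<in> carrier A \<Longrightarrow> b \<in> carrier A \<Longrightarrow> act v (a \<oplus> b) = act v a + act v b"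
    and act_scale_right: "v \<in> V \<Longrightarrow> a \<in> carrier A \<Longrightarrow> act v (c \<odot> a) = sc c (act v a)"
    and act_mult:
      "v \<in> V \<Longrightarrow> a \<in> carrier A \<Longrightarrow> b \<in> carrier A \<Longrightarrow> act v (a \<otimes> b) = act (act v a) b"
    and act_one: "v \<in> V \<Longrightarrow> act v \<one> = v"


section \<open>The q-Brauer algebra\<close>

datatype brauer_gen = GenH nat | GenE

abbreviation fH :: "nat \<Rightarrow> (brauer_gen word \<Rightarrow>\<^sub>0 'k::field)" where
  "fH i \<equiv> generator (GenH i)"

abbreviation fE :: "brauer_gen word \<Rightarrow>\<^sub>0 'k::field" where
  "fE \<equiv> generator GenE"

text \<open>The parameters are meant to satisfy \<open>x \<noteq> 0\<close>, \<open>z \<noteq> 0\<close> and \<open>x \<noteq> x\<inverse>\<close>; otherwise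
  HOL's convention for division by zero enters the relations.

  The quadratic relation makes \<open>H\<^sub>i\<close> invertible with inverse
  \<open>H\<^sub>i - (x - x\<inverse>)\<close>; see \<open>qBrauer_H_inverse\<close> below.\<close>

definition fHinv :: "'k::field \<Rightarrow> nat \<Rightarrow> (brauer_gen word \<Rightarrow>\<^sub>0 'k)" where
  "fHinv x i = fH i - scalar (x - inverse x)"

definition fE2 :: "'k::field \<Rightarrow> (brauer_gen word \<Rightarrow>\<^sub>0 'k)" where
  "fE2 x = fE * (fH 2 * fH 3 * fHinv x 1 * fHinv x 2) * fE"

definition qBrauer_gens :: "nat \<Rightarrow> brauer_gen set" where
  "qBrauer_gens n = insert GenE (GenH ` {1..<n})"

inductive_set qBrauer_rels ::
    "nat \<Rightarrow> 'k::field \<Rightarrow> 'k \<Rightarrow> ((brauer_gen word \<Rightarrow>\<^sub>0 'k) \<times> (brauer_gen word \<Rightarrow>\<^sub>0 'k)) set"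
  for n :: nat and x z :: "'k::field" where
  quadratic: "1 \<le> i \<Longrightarrow> i < n \<Longrightarrow>
    ((fH i - scalar x) * (fH i + scalar (inverse x)), 0) \<in> qBrauer_rels n x z"
| braid: "1 \<le> i \<Longrightarrow> i + 1 < n \<Longrightarrow>
    (fH i * fH (i + 1) * fH i, fH (i + 1) * fH i * fH (i + 1)) \<in> qBrauer_rels n x z"
| far_commute: "1 \<le> i \<Longrightarrow> i < n \<Longrightarrow> 1 \<le> j \<Longrightarrow> j < n \<Longrightarrow> \<bar>int i - int j\<bar> > 1 \<Longrightarrow>
    (fH i * fH j, fH j * fH i) \<in> qBrauer_rels n x z"
| e_square: "(fE * fE, scalar ((z - inverse z) / (x - inverse x)) * fE) \<in> qBrauer_rels n x z"
| H1_e: "1 < n \<Longrightarrow> (fH 1 * fE, scalar x * fE) \<in> qBrauer_rels n x z"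
| e_H1: "1 < n \<Longrightarrow> (fE * fH 1, scalar x * fE) \<in> qBrauer_rels n x z"
| e_H2_e: "2 < n \<Longrightarrow> (fE * fH 2 * fE, scalar z * fE) \<in> qBrauer_rels n x z"
| H_e_commute: "2 < i \<Longrightarrow> i < n \<Longrightarrow> (fH i * fE, fE * fH i) \<in> qBrauer_rels n x z"
| e2_left: "3 < n \<Longrightarrow>
    (fH 2 * fH 3 * fHinv x 1 * fHinv x 2 * fE2 x, fE2 x) \<in> qBrauer_rels n x z"
| e2_right: "3 < n \<Longrightarrow>
    (fE2 x * (fH 2 * fH 3 * fHinv x 1 * fHinv x 2), fE2 x) \<in> qBrauer_rels n x z"

definition qBrauer ::
    "nat \<Rightarrow> 'k::field \<Rightarrow> 'k \<Rightarrow> ('k, (brauer_gen word \<Rightarrow>\<^sub>0 'k) set) module" where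
  "qBrauer n x z = presented_algebra (qBrauer_gens n) (qBrauer_rels n x z)"

definition qBrauer_class ::
    "nat \<Rightarrow> 'k::field \<Rightarrow> 'k \<Rightarrow> (brauer_gen word \<Rightarrow>\<^sub>0 'k) \<Rightarrow> (brauer_gen word \<Rightarrow>\<^sub>0 'k) set" where
  "qBrauer_class n x z = presented_class (qBrauer_gens n) (qBrauer_rels n x z)"

definition qBrauer_H :: "nat \<Rightarrow> 'k::field \<Rightarrow> 'k \<Rightarrow> nat \<Rightarrow> (brauer_gen word \<Rightarrow>\<^sub>0 'k) set" where
  "qBrauer_H n x z i = qBrauer_class n x z (fH i)"

definition qBrauer_e :: "nat \<Rightarrow> 'k::field \<Rightarrow> 'k \<Rightarrow> (brauer_gen word \<Rightarrow>\<^sub>0 'k) set" where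
  "qBrauer_e n x z = qBrauer_class n x z fE"


section \<open>The field of rational functions and the tensor space\<close>

type_synonym ratfun = "rat poly fract"

definition q :: ratfun where
  "q = Fract [:0, 1:] 1"

definition int_laurent :: "ratfun set" where
  "int_laurent = {\<Sum>i\<in>I. of_int (c i) * q powi i | (I :: int set) (c :: int \<Rightarrow> int). finite I}"

definition \<kappa> :: "(nat \<Rightarrow> ratfun) \<Rightarrow> nat \<Rightarrow> ratfun" where
  "\<kappa> \<sigma> i = (\<Prod>j\<in>{1..<i}. - \<sigma> (2 * j))"

abbreviation qBr :: "nat \<Rightarrow> nat \<Rightarrow> (ratfun, (brauer_gen word \<Rightarrow>\<^sub>0 ratfun) set) module" where
  "qBr m n \<equiv> qBrauer n (- inverse q) (q ^ (2 * m))"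

abbreviation qBr_H :: "nat \<Rightarrow> nat \<Rightarrow> nat \<Rightarrow> (brauer_gen word \<Rightarrow>\<^sub>0 ratfun) set" where
  "qBr_H m n \<equiv> qBrauer_H n (- inverse q) (q ^ (2 * m))"

abbreviation qBr_e :: "nat \<Rightarrow> nat \<Rightarrow> (brauer_gen word \<Rightarrow>\<^sub>0 ratfun) set" where
  "qBr_e m n \<equiv> qBrauer_e n (- inverse q) (q ^ (2 * m))"

text \<open>The \<open>n\<close>-th tensor power of the space with basis \<open>v\<^sub>1, \<dots>, v\<^sub>d\<close> is the space with
  basis the tensors \<open>v\<^sub>a\<^sub>1 \<otimes> \<dots> \<otimes> v\<^sub>a\<^sub>n\<close>, indexed by lists of length \<open>n\<close>. Lists are
  numbered from 0, so the \<open>k\<close>-th factor has index \<open>a ! (k - 1)\<close>.\<close>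

definition tensor_indices :: "nat \<Rightarrow> nat \<Rightarrow> nat list set" where
  "tensor_indices d n = {a. length a = n \<and> set a \<subseteq> {1..d}}"

definition tensor_power :: "nat \<Rightarrow> nat \<Rightarrow> (nat list \<Rightarrow>\<^sub>0 'k::field) set" where
  "tensor_power d n = {t. Poly_Mapping.keys t \<subseteq> tensor_indices d n}"

definition vtensor :: "nat list \<Rightarrow> (nat list \<Rightarrow>\<^sub>0 'k::field)" where
  "vtensor a = Poly_Mapping.single a 1"

definition interchange :: "nat \<Rightarrow> 'i list \<Rightarrow> 'i list" where
  "interchange k a = a[k - 1 := a ! k, k := a ! (k - 1)]"


section \<open>Well-formedness of the constructions\<close>

lemma lookup_scale [simp]: "Poly_Mapping.lookup (scale c f) i = c * Poly_Mapping.lookup f i"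
  by (simp add: scale_def map.rep_eq when_def)

lemma vector_space_scale: "vector_space (scale :: 'k::field \<Rightarrow> ('i \<Rightarrow>\<^sub>0 'k) \<Rightarrow> _)"
  by unfold_locales (auto intro!: poly_mapping_eqI simp: lookup_add algebra_simps)

lemma scale_eq_scalar_mult: "scale c f = scalar c * f"
  by (simp add: scale_def mult_map_scale_conv_mult)

lemma tensor_power_subspace:
  "module.subspace scale (tensor_power d n :: (nat list \<Rightarrow>\<^sub>0 'k::field) set)"
proof -
  interpret vector_space "scale :: 'k \<Rightarrow> (nat list \<Rightarrow>\<^sub>0 'k) \<Rightarrow> _" by (rule vector_space_scale)
  show ?thesis
  proof (rule subspaceI)
    show "0 \<in> (tensor_power d n :: (nat list \<Rightarrow>\<^sub>0 'k) set)"
      by (simp add: tensor_power_def)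
    fix s t :: "nat list \<Rightarrow>\<^sub>0 'k" and c :: 'k
    assume s: "s \<in> tensor_power d n"
    show "scale c s \<in> tensor_power d n"
      using s by (auto simp: tensor_power_def in_keys_iff)
    assume "t \<in> tensor_power d n"
    with s show "s + t \<in> tensor_power d n"
      using keys_add[of s t] by (auto simp: tensor_power_def)
  qed
qed

lemma vtensor_in_tensor_power: "a \<in> tensor_indices d n \<Longrightarrow> vtensor a \<in> tensor_power d n"
  by (simp add: vtensor_def tensor_power_def)

lemma free_algebra_simps [simp]:
  "mult (free_algebra G) = (*)" "one (free_algebra G) = 1" "zero (free_algebra G) = 0"
  "add (free_algebra G) = (+)" "smult (free_algebra G) = scale"
  by (simp_all add: free_algebra_def)

lemma free_algebra_carrier_iff:
  "f \<in> carrier (free_algebra G) \<longleftrightarrow> (\<forall>w\<in>Poly_Mapping.keys f. set (letters w) \<subseteq> G)"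
  by (simp add: free_algebra_def)

lemma generator_in_free_algebra: "g \<in> G \<Longrightarrow> generator g \<in> carrier (free_algebra G)"
  by (simp add: free_algebra_carrier_iff)

lemma scalar_in_free_algebra: "scalar c \<in> carrier (free_algebra G)"
  by (simp add: free_algebra_carrier_iff zero_word_def)

lemma free_algebra_closed:
  assumes "f \<in> carrier (free_algebra G)" "g \<in> carrier (free_algebra G)"
  shows "f + g \<in> carrier (free_algebra G)" "f - g \<in> carrier (free_algebra G)"
    "- f \<in> carrier (free_algebra G)" "f * g \<in> carrier (free_algebra G)"
proof -
  show "f + g \<in> carrier (free_algebra G)"
    using assms keys_add[of f g] unfolding free_algebra_carrier_iff by blast
  show "f - g \<in> carrier (free_algebra G)"
    using assms keys_diff[of f g] unfolding free_algebra_carrier_iff by blast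
  show "- f \<in> carrier (free_algebra G)"
    using assms by (simp add: free_algebra_carrier_iff)
  show "f * g \<in> carrier (free_algebra G)"
    unfolding free_algebra_carrier_iff
  proof
    fix w assume "w \<in> Poly_Mapping.keys (f * g)"
    then obtain u v where "w = u + v" "u \<in> Poly_Mapping.keys f" "v \<in> Poly_Mapping.keys g"
      using keys_mult[of f g] by blast
    then show "set (letters w) \<subseteq> G"
      using assms by (auto simp: free_algebra_carrier_iff plus_word_def)
  qed
qed

lemma free_algebra_ring: "ring (free_algebra G)"
proof (rule ringI)
  show "abelian_group (free_algebra G)"
  proof (rule abelian_groupI)
    fix f assume f: "f \<in> carrier (free_algebra G)"
    show "\<exists>g\<in>carrier (free_algebra G). g \<oplus>\<^bsub>free_algebra G\<^esub> f = \<zero>\<^bsub>free_algebra G\<^esub>"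
      by (rule bexI[of _ "- f"]) (simp_all add: free_algebra_closed[OF f f])
  qed (auto simp: free_algebra_closed free_algebra_carrier_iff[of 0] ac_simps)
  show "Group.monoid (free_algebra G)"
    by (rule monoidI)
      (auto simp: free_algebra_closed mult.assoc scalar_in_free_algebra[of 1, simplified])
qed (simp_all add: distrib_left distrib_right)

lemma qBrauer_rels_in_free_algebra:
  assumes "(l, r) \<in> qBrauer_rels n x z"
  shows "l \<in> carrier (free_algebra (qBrauer_gens n))" "r \<in> carrier (free_algebra (qBrauer_gens n))"
  using assms
  by (induction) (simp_all add: fE2_def fHinv_def free_algebra_closed generator_in_free_algebra
      scalar_in_free_algebra qBrauer_gens_def free_algebra_carrier_iff[of 0])

lemma qBrauer_ideal: "ideal (relation_ideal (qBrauer_gens n) (qBrauer_rels n x z)) (free_algebra (qBrauer_gens n))"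
  unfolding relation_ideal_def
  by (rule ring.genideal_ideal[OF free_algebra_ring])
    (auto intro: free_algebra_closed qBrauer_rels_in_free_algebra)

lemma qBrauer_simps:
  "carrier (qBrauer n x z) = qBrauer_class n x z ` carrier (free_algebra (qBrauer_gens n))"
  "one (qBrauer n x z) = qBrauer_class n x z 1"
  by (auto simp: qBrauer_def presented_algebra_def ring.defs FactRing_def qBrauer_class_def
      presented_class_def A_RCOSETS_def RCOSETS_def a_r_coset_def)

lemma qBrauer_class_ops:
  assumes f: "f \<in> carrier (free_algebra (qBrauer_gens n))"
    and g: "g \<in> carrier (free_algebra (qBrauer_gens n))"
  shows "qBrauer_class n x z f \<oplus>\<^bsub>qBrauer n x z\<^esub> qBrauer_class n x z g = qBrauer_class n x z (f + g)"
    and "qBrauer_class n x z f \<otimes>\<^bsub>qBrauer n x z\<^esub> qBrauer_class n x z g = qBrauer_class n x z (f * g)"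
    and "c \<odot>\<^bsub>qBrauer n x z\<^esub> qBrauer_class n x z f = qBrauer_class n x z (scale c f)"
proof -
  let ?F = "free_algebra (qBrauer_gens n) :: ('a, _) module"
  let ?I = "relation_ideal (qBrauer_gens n) (qBrauer_rels n x z)"
  interpret ideal ?I ?F by (rule qBrauer_ideal)
  show "qBrauer_class n x z f \<oplus>\<^bsub>qBrauer n x z\<^esub> qBrauer_class n x z g = qBrauer_class n x z (f + g)"
    using a_rcos_sum[OF f g]
    by (simp add: qBrauer_def presented_algebra_def ring.defs FactRing_def qBrauer_class_def
        presented_class_def)
  show "qBrauer_class n x z f \<otimes>\<^bsub>qBrauer n x z\<^esub> qBrauer_class n x z g = qBrauer_class n x z (f * g)"
    using rcoset_mult_add[OF f g]
    by (simp add: qBrauer_def presented_algebra_def ring.defs FactRing_def qBrauer_class_def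
        presented_class_def)
  have s: "scale c h \<in> carrier ?F" if "h \<in> carrier ?F" for h
    using that by (simp add: scale_eq_scalar_mult free_algebra_closed scalar_in_free_algebra)
  have "?I +>\<^bsub>?F\<^esub> scale c h = ?I +>\<^bsub>?F\<^esub> scale c f" if h: "h \<in> ?I +>\<^bsub>?F\<^esub> f" for h
  proof -
    obtain i where i: "i \<in> ?I" "h = i + f"
      using h by (auto simp: a_r_coset_def r_coset_def)
    have "scale c h = scale c i + scale c f"
      by (simp add: i scale_eq_scalar_mult distrib_left)
    moreover have "scale c i \<in> ?I"
      using I_l_closed[OF i(1), of "scalar c"]
      by (simp add: scale_eq_scalar_mult scalar_in_free_algebra)
    ultimately have "scale c h \<in> ?I +>\<^bsub>?F\<^esub> scale c f"
      by (auto simp: a_r_coset_def r_coset_def)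
    then show ?thesis
      using a_repr_independence[OF _ s[OF f] is_additive_subgroup[THEN additive_subgroup.a_subgroup]] by simp
  qed
  then have "(\<Union>h\<in>?I +>\<^bsub>?F\<^esub> f. ?I +>\<^bsub>?F\<^esub> scale c h) = ?I +>\<^bsub>?F\<^esub> scale c f"
    using a_rcos_self[OF f] by blast
  then show "c \<odot>\<^bsub>qBrauer n x z\<^esub> qBrauer_class n x z f = qBrauer_class n x z (scale c f)"
    by (simp add: qBrauer_def presented_algebra_def ring.defs qBrauer_class_def presented_class_def)
qed

lemma ring_extend:
  fixes R (structure)
  assumes "ring R"
  shows "ring (ring.extend R X)"
proof -
  interpret ring R by fact
  have [simp]: "carrier (ring.extend R X) = carrier R" "mult (ring.extend R X) = mult R"
    "one (ring.extend R X) = one R" "add (ring.extend R X) = add R" "zero (ring.extend R X) = zero R"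
    by (simp_all add: ring.defs)
  show ?thesis
  proof (rule ringI)
    show "abelian_group (ring.extend R X)"
    proof (rule abelian_groupI)
      fix a assume "a \<in> carrier (ring.extend R X)"
      then show "\<exists>b\<in>carrier (ring.extend R X). b \<oplus>\<^bsub>ring.extend R X\<^esub> a = \<zero>\<^bsub>ring.extend R X\<^esub>"
        by (intro bexI[of _ "\<ominus> a"]) (simp_all add: l_neg)
    qed (simp_all add: a_ac)
    show "Group.monoid (ring.extend R X)"
      by (rule monoidI) (simp_all add: m_assoc)
  qed (simp_all add: l_distr r_distr)
qed

lemma qBrauer_ring: "ring (qBrauer n x z)"
  unfolding qBrauer_def presented_algebra_def
  by (rule ring_extend[OF ideal.quotient_is_ring[OF qBrauer_ideal]])

lemma qBrauer_class_eq:
  assumes "(l, r) \<in> qBrauer_rels n x z"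
  shows "qBrauer_class n x z l = qBrauer_class n x z r"
proof -
  interpret ideal "relation_ideal (qBrauer_gens n) (qBrauer_rels n x z)"
    "free_algebra (qBrauer_gens n)"
    by (rule qBrauer_ideal)
  have "{l - r |l r. (l, r) \<in> qBrauer_rels n x z} \<subseteq> carrier (free_algebra (qBrauer_gens n))"
    by (auto intro: free_algebra_closed qBrauer_rels_in_free_algebra)
  then have "l - r \<in> relation_ideal (qBrauer_gens n) (qBrauer_rels n x z)"
    unfolding relation_ideal_def using genideal_self assms by blast
  then have "l \<in> relation_ideal (qBrauer_gens n) (qBrauer_rels n x z)
      +>\<^bsub>free_algebra (qBrauer_gens n)\<^esub> r"
    by (force simp: a_r_coset_def r_coset_def)
  then show ?thesis
    using a_repr_independence[OF _ qBrauer_rels_in_free_algebra(2)[OF assms] a_subgroup]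
    by (simp add: qBrauer_class_def presented_class_def)
qed

lemma qBrauer_H_inverse:
  fixes x z :: "'a::field"
  assumes "1 \<le> i" "i < n" "x \<noteq> 0"
  shows "qBrauer_H n x z i \<otimes>\<^bsub>qBrauer n x z\<^esub> qBrauer_class n x z (fHinv x i) = \<one>\<^bsub>qBrauer n x z\<^esub>"
    and "qBrauer_class n x z (fHinv x i) \<otimes>\<^bsub>qBrauer n x z\<^esub> qBrauer_H n x z i = \<one>\<^bsub>qBrauer n x z\<^esub>"
proof -
  let ?F = "free_algebra (qBrauer_gens n) :: ('a, _) module"
  let ?Q = "(fH i - scalar x) * (fH i + scalar (inverse x))"
  have H: "(fH i :: brauer_gen word \<Rightarrow>\<^sub>0 'a) \<in> carrier ?F"
    by (rule generator_in_free_algebra) (use assms in \<open>simp add: qBrauer_gens_def\<close>)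
  then have inv: "fHinv x i \<in> carrier ?F"
    by (simp add: fHinv_def free_algebra_closed scalar_in_free_algebra)
  have Q: "?Q \<in> carrier ?F"
    using H by (simp add: free_algebra_closed scalar_in_free_algebra)
  have one: "1 \<in> carrier ?F"
    using scalar_in_free_algebra[of 1] by simp
  have comm: "fH i * scalar c = scalar c * fH i" for c :: 'a
    by (simp add: mult_single)
  have xx: "scalar x * scalar (inverse x) = 1"
    using assms by (simp add: mult_single)
  have sc: "scalar (x - inverse x) = scalar x - scalar (inverse x)"
    by (simp add: single_diff)
  have 1: "fH i * fHinv x i = ?Q + 1"
    unfolding fHinv_def sc by (simp add: algebra_simps comm xx)
  have 2: "fHinv x i * fH i = ?Q + 1"
    unfolding fHinv_def sc by (simp add: algebra_simps comm xx)
  have "qBrauer_class n x z (?Q + 1)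
      = qBrauer_class n x z 0 \<oplus>\<^bsub>qBrauer n x z\<^esub> qBrauer_class n x z 1"
    using qBrauer_class_ops(1)[OF Q one, of x z] qBrauer_class_eq[OF qBrauer_rels.quadratic[OF assms(1,2), of x z]]
    by simp
  also have "\<dots> = \<one>\<^bsub>qBrauer n x z\<^esub>"
    using qBrauer_class_ops(1)[OF free_algebra_carrier_iff[of 0, THEN iffD2] one, of x z]
    by (simp add: qBrauer_simps)
  finally have "qBrauer_class n x z (?Q + 1) = \<one>\<^bsub>qBrauer n x z\<^esub>" .
  then show "qBrauer_H n x z i \<otimes>\<^bsub>qBrauer n x z\<^esub> qBrauer_class n x z (fHinv x i) = \<one>\<^bsub>qBrauer n x z\<^esub>"
    and "qBrauer_class n x z (fHinv x i) \<otimes>\<^bsub>qBrauer n x z\<^esub> qBrauer_H n x z i = \<one>\<^bsub>qBrauer n x z\<^esub>"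
    unfolding qBrauer_H_def qBrauer_class_ops(2)[OF H inv] qBrauer_class_ops(2)[OF inv H] 1 2
    by (simp_all only:)
qed

end

theory Submission
  imports Defs
begin

text \<open>
  Two letters \<open>2j - 1\<close>, \<open>2j\<close> form a pair. Put
  \<open>u\<^sub>j = v\<^bsub>2j-1\<^esub> \<otimes> v\<^bsub>2j\<^esub> - q v\<^bsub>2j\<^esub> \<otimes> v\<^bsub>2j-1\<^esub>\<close>. The operator prescribed for \<open>e\<close> factors as a cap
  followed by a cup: the cap removes the first two tensor factors and returns a scalar, which is
  \<open>\<beta>\<^sub>i\<close> on \<open>v\<^bsub>2i-1\<^esub> \<otimes> v\<^bsub>2i\<^esub>\<close> and \<open>- q \<beta>\<^sub>i\<close> on the reversed word, and the cup puts the vector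
  \<open>\<Sum>\<^sub>j \<alpha>\<^sub>j u\<^sub>j\<close> in front. Here \<open>\<beta>\<^sub>i = \<kappa>\<^sub>i q\<^bsup>-3i\<^esup>\<close> and \<open>\<alpha>\<^sub>j = \<kappa>\<^sub>j\<^bsup>-1\<^esup> q\<^bsup>2m+1-j\<^esup>\<close>, and almost everything
  depends only on the product \<open>\<beta>\<^sub>j \<alpha>\<^sub>j = q\<^bsup>2m+1-4j\<^esup>\<close>, in which \<open>\<kappa>\<close> cancels.

  The Hecke relations are computations with the letters at the places concerned, and the generators
  \<open>H\<^sub>k\<close> with \<open>k > 2\<close> slide through cups and caps (\<open>hecke_cup\<close>, \<open>hecke_cap\<close>). The relations
  that involve \<open>e\<close> become statements about closing up a cup with a cap:

  \<^item> \<open>H\<^sub>1\<close> acts by \<open>- 1 / q\<close> on each \<open>u\<^sub>j\<close>, and dually on the cap.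

  \<^item> A closed loop and a loop crossed by one strand are geometric sums in \<open>q\<^bsup>-4\<^esup>\<close>, which
    telescope to \<open>(z - 1/z) / (q - 1/q)\<close> and to \<open>z\<close> (\<open>cap_cup_weight\<close>, \<open>cap_hecke_2_cup\<close>).

  \<^item> Let \<open>G = H\<^sub>2 H\<^sub>3 H\<^sub>1\<^bsup>-1\<^esup> H\<^sub>2\<^bsup>-1\<^esup>\<close>, here called \<open>transit\<close>. Then cup, \<open>G\<close> and cap in succession equal
    cap followed by cup (\<open>cap_transit_cup\<close>). Thus \<open>e\<^bsub>(2)\<^esub> = e G e\<close> is a double cap followed by a
    double cup. On a word \<open>c < d\<close> that forms a pair, the arc \<open>u\<^sub>j\<close> of the cup is all that survives; on
    another word \<open>c < d\<close> the arcs between \<open>c\<close> and \<open>d\<close> contribute a telescoping sum, which is zero;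
    all other words follow from \<open>H\<^sub>3 G = G H\<^sub>1\<close>.

  \<^item> It remains to see that \<open>G\<close> fixes a double cup and a double cap. For a double cup it is enough
    that \<open>H\<^sub>2 H\<^sub>1\<close> and \<open>H\<^sub>2 H\<^sub>3\<close> agree on it, and they agree on each \<open>u\<^sub>i \<otimes> u\<^sub>j + u\<^sub>j \<otimes> u\<^sub>i\<close>. As each
    \<open>H\<^sub>k\<close> is a symmetric matrix in the basis of words and a cap is the transpose of a cup,
    it follows that \<open>H\<^sub>1 H\<^sub>2\<close> and \<open>H\<^sub>3 H\<^sub>2\<close> agree when a double cap comes next. The same then holds with
    \<open>H\<^sub>2\<^bsup>-1\<^esup>\<close> for \<open>H\<^sub>2\<close>, because \<open>H\<^sub>1\<close> and \<open>H\<^sub>3\<close> act on a double cap by the same scalar, and this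
    is what a double cap needs.

  Finally, operators that satisfy the defining relations on an invariant subspace define a right
  action of the presented algebra (\<open>qBrauer_right_action\<close>).\<close>

section \<open>Linear extension from a basis\<close>

abbreviation linear_op :: "(('i \<Rightarrow>\<^sub>0 'k::field) \<Rightarrow> ('j \<Rightarrow>\<^sub>0 'k)) \<Rightarrow> bool" where
  "linear_op \<equiv> Vector_Spaces.linear scale scale"

lemma linear_opI:
  assumes "\<And>x y. F (x + y) = F x + F y" and "\<And>c x. F (scale c x) = scale c (F x)"
  shows "linear_op F"
  using assms by (simp add: Vector_Spaces.linear_iff vector_space_scale)

lemmas linear_op_add = module_hom.add[OF Vector_Spaces.linear.axioms(3)]
  and linear_op_scale = module_hom.scale[OF Vector_Spaces.linear.axioms(3)]
  and linear_op_zero = module_hom.zero[OF Vector_Spaces.linear.axioms(3)]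
  and linear_op_diff = module_hom.diff[OF Vector_Spaces.linear.axioms(3)]
  and linear_op_sum = module_hom.sum[OF Vector_Spaces.linear.axioms(3)]

lemmas linear_op_simps = linear_op_add linear_op_scale linear_op_zero linear_op_diff linear_op_sum

lemma scale_simps [simp]:
  "scale c 0 = 0" "scale 0 x = 0" "scale 1 x = x" "scale c (scale d x) = scale (c * d) x"
  by (auto intro!: poly_mapping_eqI simp: mult.assoc)

lemma scale_distrib:
  "scale c (x + y) = scale c x + scale c y" "scale c (x - y) = scale c x - scale c y"
  "scale (c + d) x = scale c x + scale d x" "scale (c - d) x = scale c x - scale d x"
  by (auto intro!: poly_mapping_eqI simp: lookup_add lookup_minus algebra_simps)

lemma scale_sum: "scale c (\<Sum>i\<in>I. f i) = (\<Sum>i\<in>I. scale c (f i))"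
  by (induction I rule: infinite_finite_induct) (simp_all add: scale_distrib)

lemma scale_eq_imp_zero:
  assumes "scale a x = scale b x" and "a \<noteq> b"
  shows "x = 0"
proof (rule poly_mapping_eqI)
  fix i
  have "a * Poly_Mapping.lookup x i = b * Poly_Mapping.lookup x i"
    using arg_cong[OF assms(1), of "\<lambda>y. Poly_Mapping.lookup y i"] by simp
  with assms(2) show "Poly_Mapping.lookup x i = Poly_Mapping.lookup 0 i" by simp
qed

lemma linear_op_plus:
  assumes F: "linear_op F" and G: "linear_op G"
  shows "linear_op (\<lambda>x. F x + G x)"
  by (rule linear_opI) (simp_all add: linear_op_simps[OF F] linear_op_simps[OF G] scale_distrib)

lemma linear_op_minus:
  assumes F: "linear_op F" and G: "linear_op G"
  shows "linear_op (\<lambda>x. F x - G x)"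
  by (rule linear_opI) (simp_all add: linear_op_simps[OF F] linear_op_simps[OF G] scale_distrib)

lemma linear_op_scaled:
  assumes F: "linear_op F"
  shows "linear_op (\<lambda>x. scale c (F x))"
  by (rule linear_opI) (simp_all add: linear_op_simps[OF F] scale_distrib mult.commute)

lemma linear_op_null: "linear_op (\<lambda>x. 0)"
  by (rule linear_opI) simp_all

lemma linear_op_compose:
  assumes "linear_op F" and "linear_op G"
  shows "linear_op (\<lambda>x. F (G x))"
  using Vector_Spaces.linear_compose[OF assms(2,1)] by (simp add: comp_def)

lemma linear_op_ident: "linear_op (\<lambda>x. x)"
  by (rule linear_opI) simp_all

lemma linear_op_sum_of:
  assumes "\<And>i. i \<in> I \<Longrightarrow> linear_op (F i)"
  shows "linear_op (\<lambda>x. \<Sum>i\<in>I. F i x)"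
  by (rule linear_opI)
    (simp_all add: linear_op_add[OF assms] linear_op_scale[OF assms] sum.distrib scale_sum)

lemmas linear_op_intros = linear_op_plus linear_op_minus linear_op_scaled linear_op_null
  linear_op_ident linear_op_sum_of

definition linear_ext :: "('i \<Rightarrow> ('j \<Rightarrow>\<^sub>0 'k::field)) \<Rightarrow> ('i \<Rightarrow>\<^sub>0 'k) \<Rightarrow> ('j \<Rightarrow>\<^sub>0 'k)" where
  "linear_ext B x = (\<Sum>i\<in>Poly_Mapping.keys x. scale (Poly_Mapping.lookup x i) (B i))"

lemma linear_ext_superset:
  assumes "finite S" and "Poly_Mapping.keys x \<subseteq> S"
  shows "linear_ext B x = (\<Sum>i\<in>S. scale (Poly_Mapping.lookup x i) (B i))"
  unfolding linear_ext_def
  by (rule sum.mono_neutral_left) (use assms in \<open>auto simp: in_keys_iff\<close>)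

lemma linear_ext_linear:
  fixes B :: "'i \<Rightarrow> ('j \<Rightarrow>\<^sub>0 'k::field)"
  shows "linear_op (linear_ext B)"
proof (rule linear_opI)
  fix x y :: "'i \<Rightarrow>\<^sub>0 'k" and c :: 'k
  let ?S = "Poly_Mapping.keys x \<union> Poly_Mapping.keys y"
  have "linear_ext B z = (\<Sum>i\<in>?S. scale (Poly_Mapping.lookup z i) (B i))"
    if "Poly_Mapping.keys z \<subseteq> ?S" for z
    using that by (intro linear_ext_superset) auto
  from this[of x] this[of y] this[of "x + y"]
  show "linear_ext B (x + y) = linear_ext B x + linear_ext B y"
    using keys_add[of x y] by (simp add: lookup_add scale_distrib sum.distrib)
  have "Poly_Mapping.keys (scale c x) \<subseteq> Poly_Mapping.keys x"
    by (auto simp: in_keys_iff)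
  from linear_ext_superset[OF finite_keys this, of B]
  show "linear_ext B (scale c x) = scale c (linear_ext B x)"
    by (simp add: linear_ext_def scale_sum)
qed

lemma linear_ext_single [simp]: "linear_ext B (Poly_Mapping.single i c) = scale c (B i)"
  by (simp add: linear_ext_def)

lemma poly_mapping_expand:
  "(\<Sum>i\<in>Poly_Mapping.keys x. scale (Poly_Mapping.lookup x i) (Poly_Mapping.single i 1)) = x"
  by (rule poly_mapping_eqI)
    (auto simp: lookup_sum lookup_single when_def in_keys_iff if_distrib cong: if_cong)

lemma linear_op_eqI:
  assumes F: "linear_op F" and G: "linear_op G"
    and eq: "\<And>i. i \<in> Poly_Mapping.keys x \<Longrightarrow>
      F (Poly_Mapping.single i 1) = G (Poly_Mapping.single i 1)"
  shows "F x = G x"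
proof -
  have "F x = (\<Sum>i\<in>Poly_Mapping.keys x.
      scale (Poly_Mapping.lookup x i) (F (Poly_Mapping.single i 1)))" (is "_ = ?s F")
    by (subst (1) poly_mapping_expand[of x, symmetric]) (simp add: linear_op_simps[OF F])
  also have "\<dots> = ?s G"
    by (rule sum.cong) (simp_all add: eq)
  also have "\<dots> = G x"
    by (subst (3) poly_mapping_expand[of x, symmetric]) (simp add: linear_op_simps[OF G])
  finally show ?thesis .
qed

section \<open>Right actions of a presented algebra\<close>

definition word_act :: "('g \<Rightarrow> 'v \<Rightarrow> 'v) \<Rightarrow> 'v \<Rightarrow> 'g word \<Rightarrow> 'v" where
  "word_act \<phi> v w = fold \<phi> (letters w) v"

definition free_act ::
    "('g \<Rightarrow> ('i \<Rightarrow>\<^sub>0 'k) \<Rightarrow> ('i \<Rightarrow>\<^sub>0 'k)) \<Rightarrow> ('i \<Rightarrow>\<^sub>0 'k) \<Rightarrow> ('g word \<Rightarrow>\<^sub>0 'k::field) \<Rightarrow> ('i \<Rightarrow>\<^sub>0 'k)" where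
  "free_act \<phi> v = linear_ext (word_act \<phi> v)"

lemma free_act_linear_right: "linear_op (free_act \<phi> v)"
  unfolding free_act_def by (rule linear_ext_linear)

lemma free_act_basic [simp]:
  "free_act \<phi> v (Poly_Mapping.single w c) = scale c (word_act \<phi> v w)"
  "free_act \<phi> v 1 = v"
  by (simp_all add: free_act_def word_act_def zero_word_def flip: single_one)

lemma free_act_linear_left:
  assumes "\<And>g. linear_op (\<phi> g)"
  shows "linear_op (\<lambda>v. free_act \<phi> v f)"
proof -
  have "linear_op (fold \<phi> gs)" for gs
    by (induction gs) (auto simp: comp_def id_def intro: linear_op_ident linear_op_compose assms)
  then show ?thesis
    unfolding free_act_def linear_ext_def word_act_def
    by (intro linear_op_sum_of linear_op_scaled)
qed

lemma scalar_central: "f * scalar c = scalar c * f"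
proof -
  have "(\<Sum>w\<in>I. scale (d w) (Poly_Mapping.single w 1)) * scalar c
      = scalar c * (\<Sum>w\<in>I. scale (d w) (Poly_Mapping.single w 1))" for I and d :: "'a word \<Rightarrow> 'b"
    by (simp add: sum_distrib_left sum_distrib_right scale_eq_scalar_mult mult_single mult.commute)
  from this[of "Poly_Mapping.lookup f" "Poly_Mapping.keys f"] show ?thesis
    by (simp only: poly_mapping_expand)
qed

lemma mult_linear:
  fixes h :: "'g word \<Rightarrow>\<^sub>0 'k::field"
  shows "linear_op (\<lambda>f. f * h)" and "linear_op (\<lambda>f. h * f)"
proof -
  show "linear_op (\<lambda>f. f * h)"
    by (rule linear_opI) (simp_all add: distrib_right scale_eq_scalar_mult mult.assoc)
  show "linear_op (\<lambda>f. h * f)"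
    by (rule linear_opI)
      (simp_all add: distrib_left scale_eq_scalar_mult scalar_central flip: mult.assoc)
qed

text \<open>Concatenated words act one after the other, first letter first; bilinearity extends this
  to all products.\<close>

lemma free_act_mult:
  fixes \<phi> :: "'g \<Rightarrow> ('i \<Rightarrow>\<^sub>0 'k::field) \<Rightarrow> ('i \<Rightarrow>\<^sub>0 'k)"
  assumes \<phi>: "\<And>g. linear_op (\<phi> g)"
  shows "free_act \<phi> v (f * h) = free_act \<phi> (free_act \<phi> v f) h"
proof -
  have words: "free_act \<phi> v (Poly_Mapping.single u 1 * Poly_Mapping.single w 1)
      = free_act \<phi> (free_act \<phi> v (Poly_Mapping.single u 1)) (Poly_Mapping.single w 1)" for u w
    by (simp add: mult_single word_act_def plus_word_def)
  have "free_act \<phi> v (f * Poly_Mapping.single w 1)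
      = free_act \<phi> (free_act \<phi> v f) (Poly_Mapping.single w 1)" for w
    by (rule linear_op_eqI[where x = f, OF
          linear_op_compose[OF free_act_linear_right mult_linear(1)]
          linear_op_compose[OF free_act_linear_left[OF \<phi>] free_act_linear_right] words])
  then show ?thesis
    by (rule linear_op_eqI[where x = h, OF
          linear_op_compose[OF free_act_linear_right mult_linear(2)] free_act_linear_right])
qed

text \<open>The elements of the free algebra that annihilate \<open>V\<close> form a two-sided ideal, so this ideal
  contains the ideal of relations as soon as it contains the relations. That \<open>V\<close> is invariant
  makes the annihilator a left ideal.\<close>

lemma relation_ideal_annihilates:
  fixes \<phi> :: "'g \<Rightarrow> ('i \<Rightarrow>\<^sub>0 'k::field) \<Rightarrow> ('i \<Rightarrow>\<^sub>0 'k)"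
  assumes \<phi>: "\<And>g. linear_op (\<phi> g)"
    and closed: "\<And>v f. v \<in> V \<Longrightarrow> f \<in> carrier (free_algebra G) \<Longrightarrow> free_act \<phi> v f \<in> V"
    and R: "\<And>l r. (l, r) \<in> R \<Longrightarrow> l \<in> carrier (free_algebra G) \<and> r \<in> carrier (free_algebra G)"
    and rels: "\<And>l r v. (l, r) \<in> R \<Longrightarrow> v \<in> V \<Longrightarrow> free_act \<phi> v l = free_act \<phi> v r"
    and f: "f \<in> relation_ideal G R" and v: "v \<in> V"
  shows "free_act \<phi> v f = 0"
proof -
  let ?F = "free_algebra G :: ('k, _) module"
  let ?Ann = "{f \<in> carrier ?F. \<forall>v\<in>V. free_act \<phi> v f = 0}"
  interpret F: ring ?F by (rule free_algebra_ring)
  note lin = linear_op_simps[OF free_act_linear_right] free_act_mult[OF \<phi>]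
    linear_op_zero[OF free_act_linear_left[OF \<phi>]]
  have "ideal ?Ann ?F"
  proof (rule idealI)
    show "subgroup ?Ann (add_monoid ?F)"
    proof (rule group.subgroupI[OF F.a_group])
      have "0 \<in> ?Ann"
        using F.zero_closed by (simp add: lin)
      then show "?Ann \<noteq> {}"
        by blast
      fix f assume "f \<in> ?Ann"
      moreover have "inv\<^bsub>add_monoid ?F\<^esub> f = - f" if "f \<in> carrier ?F"
        by (rule group.inv_equality[OF F.a_group])
          (use that free_algebra_closed[OF that that] in simp_all)
      ultimately show "inv\<^bsub>add_monoid ?F\<^esub> f \<in> ?Ann"
        using lin(4)[of \<phi> _ 0 f] lin(3) by (auto simp: free_algebra_closed)
    qed (auto simp: lin free_algebra_closed)
  qed (auto simp: lin closed free_algebra_closed F.ring_axioms)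
  moreover have "{l - r |l r. (l, r) \<in> R} \<subseteq> ?Ann"
    using R rels by (auto simp: lin free_algebra_closed)
  ultimately have "relation_ideal G R \<subseteq> ?Ann"
    unfolding relation_ideal_def by (rule F.genideal_minimal)
  with f v show ?thesis by auto
qed

text \<open>The universal property of the presentation, for modules. The relations are required only on
  the subspace, because the operators used below make sense on tensors of every degree
  but satisfy the relations only when the tensors have enough factors.\<close>

lemma qBrauer_right_action:
  fixes \<phi> :: "brauer_gen \<Rightarrow> ('i \<Rightarrow>\<^sub>0 'k::field) \<Rightarrow> ('i \<Rightarrow>\<^sub>0 'k)" and x z :: 'k
  assumes \<phi>: "\<And>g. linear_op (\<phi> g)"
    and V: "module.subspace scale V"
    and gens: "\<And>g v. g \<in> qBrauer_gens n \<Longrightarrow> v \<in> V \<Longrightarrow> \<phi> g v \<in> V"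
    and rels: "\<And>l r v. (l, r) \<in> qBrauer_rels n x z \<Longrightarrow> v \<in> V \<Longrightarrow>
      free_act \<phi> v l = free_act \<phi> v r"
  shows "\<exists>act. right_action (qBrauer n x z) V scale act \<and>
    (\<forall>v\<in>V. \<forall>f\<in>carrier (free_algebra (qBrauer_gens n)).
      act v (qBrauer_class n x z f) = free_act \<phi> v f)"
proof -
  let ?F = "free_algebra (qBrauer_gens n) :: ('k, _) module"
  let ?I = "relation_ideal (qBrauer_gens n) (qBrauer_rels n x z)"
  interpret vector_space "scale :: 'k \<Rightarrow> ('i \<Rightarrow>\<^sub>0 'k) \<Rightarrow> _" by (rule vector_space_scale)
  interpret I: ideal ?I ?F by (rule qBrauer_ideal)
  have word_closed: "word_act \<phi> v w \<in> V" if "v \<in> V" "set (letters w) \<subseteq> qBrauer_gens n" for v w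
  proof -
    have "fold \<phi> gs v \<in> V" if "v \<in> V" "set gs \<subseteq> qBrauer_gens n" for gs v
      using that by (induction gs arbitrary: v) (auto intro: gens)
    with that show ?thesis by (simp add: word_act_def)
  qed
  have closed: "free_act \<phi> v f \<in> V" if "v \<in> V" "f \<in> carrier ?F" for v f
    unfolding free_act_def linear_ext_def
    using that by (intro subspace_sum[OF V] subspace_scale[OF V] word_closed)
      (auto simp: free_algebra_carrier_iff)
  have well_defined: "free_act \<phi> v f = free_act \<phi> v g"
    if "v \<in> V" "f \<in> carrier ?F" "g \<in> carrier ?F" "qBrauer_class n x z f = qBrauer_class n x z g"
    for v f g
  proof -
    have "f \<in> ?I +>\<^bsub>?F\<^esub> g"
      using I.a_rcos_self[OF that(2)] that(4) by (simp add: qBrauer_class_def presented_class_def)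
    then obtain i where i: "i \<in> ?I" "f = i + g"
      by (auto simp: a_r_coset_def r_coset_def)
    have "free_act \<phi> v i = 0"
      by (rule relation_ideal_annihilates[where V = V and \<phi> = \<phi>, OF \<phi> closed _ rels i(1) that(1)])
        (use qBrauer_rels_in_free_algebra in blast)+
    then show ?thesis
      by (simp add: i(2) linear_op_add[OF free_act_linear_right])
  qed
  \<comment> \<open>A coset acts through any representative; by \<open>well_defined\<close> the choice does not matter.\<close>
  define rep where
    "rep X = (SOME f. f \<in> carrier ?F \<and> qBrauer_class n x z f = X)" for X
  define act where "act v X = free_act \<phi> v (rep X)" for v X
  have act: "act v (qBrauer_class n x z f) = free_act \<phi> v f" if "v \<in> V" "f \<in> carrier ?F" for v f
  proof -
    have "rep (qBrauer_class n x z f) \<in> carrier ?F \<and>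
        qBrauer_class n x z (rep (qBrauer_class n x z f)) = qBrauer_class n x z f"
      unfolding rep_def by (rule someI[of _ f]) (simp add: that)
    then show ?thesis
      unfolding act_def using well_defined that by blast
  qed
  have scale_closed: "scale c f \<in> carrier ?F" if "f \<in> carrier ?F" for c f
    using that by (auto simp: free_algebra_carrier_iff in_keys_iff)
  have one: "1 \<in> carrier ?F"
    by (metis scalar_in_free_algebra single_one)
  note left = free_act_linear_left[OF \<phi>] and right = free_act_linear_right
  have "right_action (qBrauer n x z) V scale act"
    by unfold_locales
      (auto simp: qBrauer_simps qBrauer_class_ops act closed one scale_closed free_algebra_closed
        subspace_add[OF V] subspace_scale[OF V] free_act_mult[OF \<phi>]
        linear_op_add[OF left] linear_op_scale[OF left]
        linear_op_add[OF right] linear_op_scale[OF right])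
  with act show ?thesis by blast
qed

section \<open>Operators on tensor powers\<close>

lemma linear_op_eq_on_tensor_power:
  assumes "linear_op F" and "linear_op G"
    and "\<And>a. a \<in> tensor_indices d n \<Longrightarrow> F (vtensor a) = G (vtensor a)"
    and "v \<in> tensor_power d n"
  shows "F v = G v"
  by (rule linear_op_eqI[OF assms(1,2)])
    (use assms(3,4) in \<open>auto simp: tensor_power_def vtensor_def\<close>)

lemma tensor_power_closed:
  fixes v w :: "nat list \<Rightarrow>\<^sub>0 'k::field"
  assumes "v \<in> tensor_power d n"
  shows "w \<in> tensor_power d n \<Longrightarrow> v + w \<in> tensor_power d n"
    and "w \<in> tensor_power d n \<Longrightarrow> v - w \<in> tensor_power d n"
    and "scale c v \<in> tensor_power d n"
proof -
  interpret vector_space "scale :: 'k \<Rightarrow> (nat list \<Rightarrow>\<^sub>0 'k) \<Rightarrow> _" by (rule vector_space_scale)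
  show "w \<in> tensor_power d n \<Longrightarrow> v + w \<in> tensor_power d n"
    "w \<in> tensor_power d n \<Longrightarrow> v - w \<in> tensor_power d n" "scale c v \<in> tensor_power d n"
    using assms subspace_add[OF tensor_power_subspace] subspace_diff[OF tensor_power_subspace]
      subspace_scale[OF tensor_power_subspace] by blast+
qed

lemma tensor_power_sum:
  fixes f :: "'a \<Rightarrow> nat list \<Rightarrow>\<^sub>0 'k::field"
  assumes "\<And>i. i \<in> I \<Longrightarrow> f i \<in> tensor_power d n"
  shows "sum f I \<in> tensor_power d n"
proof -
  interpret vector_space "scale :: 'k \<Rightarrow> (nat list \<Rightarrow>\<^sub>0 'k) \<Rightarrow> _" by (rule vector_space_scale)
  show ?thesis using assms by (rule subspace_sum[OF tensor_power_subspace])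
qed

lemma linear_op_into_tensor_power:
  assumes F: "linear_op F"
    and basis: "\<And>a. a \<in> tensor_indices d n \<Longrightarrow> F (vtensor a) \<in> tensor_power d' n'"
    and v: "v \<in> tensor_power d n"
  shows "F v \<in> tensor_power d' n'"
proof -
  have "F v = (\<Sum>i\<in>Poly_Mapping.keys v.
      scale (Poly_Mapping.lookup v i) (F (Poly_Mapping.single i 1)))"
    by (subst (1) poly_mapping_expand[of v, symmetric]) (simp add: linear_op_simps[OF F])
  also have "\<dots> \<in> tensor_power d' n'"
  proof (rule tensor_power_sum, rule tensor_power_closed(3))
    fix i assume "i \<in> Poly_Mapping.keys v"
    with v have "i \<in> tensor_indices d n"
      by (auto simp: tensor_power_def)
    from basis[OF this] show "F (Poly_Mapping.single i 1) \<in> tensor_power d' n'"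
      by (simp add: vtensor_def)
  qed
  finally show ?thesis .
qed

definition prepend :: "nat list \<Rightarrow> (nat list \<Rightarrow>\<^sub>0 'k) \<Rightarrow> (nat list \<Rightarrow>\<^sub>0 'k::field)" where
  "prepend l = linear_ext (\<lambda>r. vtensor (l @ r))"

lemma prepend_linear: "linear_op (prepend l)"
  unfolding prepend_def by (rule linear_ext_linear)

lemma linear_ext_vtensor [simp]: "linear_ext B (vtensor a) = B a"
  by (simp add: vtensor_def)

lemma prepend_vtensor [simp]: "prepend l (vtensor r) = vtensor (l @ r)"
  by (simp add: prepend_def)

lemma lookup_vtensor: "Poly_Mapping.lookup (vtensor a) b = (if a = b then 1 else 0)"
  by (simp add: vtensor_def lookup_single when_def)

section \<open>The Hecke operators\<close>

locale hecke_parameter =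
  fixes t :: "'k::field"
  assumes t_nonzero [simp]: "t \<noteq> 0"

begin

text \<open>The coefficient of a word in its own image; the interchanged word has coefficient \<open>1\<close> unless
  the two letters agree.\<close>

definition stay :: "nat \<Rightarrow> nat \<Rightarrow> 'k" where
  "stay x y = (if x = y then t else if x < y then t - inverse t else 0)"

definition hecke :: "nat \<Rightarrow> (nat list \<Rightarrow>\<^sub>0 'k) \<Rightarrow> (nat list \<Rightarrow>\<^sub>0 'k)" where
  "hecke k = linear_ext (\<lambda>a. scale (stay (a ! (k - 1)) (a ! k)) (vtensor a) +
    (if a ! (k - 1) = a ! k then 0 else vtensor (interchange k a)))"

definition hecke_inv :: "nat \<Rightarrow> (nat list \<Rightarrow>\<^sub>0 'k) \<Rightarrow> (nat list \<Rightarrow>\<^sub>0 'k)" where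
  "hecke_inv k v = hecke k v - scale (t - inverse t) v"

lemma hecke_linear: "linear_op (hecke k)"
  unfolding hecke_def by (rule linear_ext_linear)

lemma hecke_inv_linear: "linear_op (hecke_inv k)"
  unfolding hecke_inv_def[abs_def]
  by (intro linear_op_intros hecke_linear)

lemmas op_simps = linear_op_simps[OF hecke_linear] linear_op_simps[OF prepend_linear]
  linear_op_simps[OF hecke_inv_linear]

lemma hecke_vtensor:
  "hecke k (vtensor a) = scale (stay (a ! (k - 1)) (a ! k)) (vtensor a) +
    (if a ! (k - 1) = a ! k then 0 else vtensor (interchange k a))"
  by (simp add: hecke_def)

text \<open>Reduces every computation to the front of a word.\<close>

lemma hecke_prepend:
  assumes "1 \<le> k"
  shows "hecke (length l + k) (prepend l v) = prepend l (hecke k v)"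
proof (rule linear_op_eqI[where x = v, OF linear_op_compose[OF hecke_linear prepend_linear]
      linear_op_compose[OF prepend_linear hecke_linear], folded vtensor_def])
  fix r
  have nth: "(l @ r) ! (length l + k - 1) = r ! (k - 1)" "(l @ r) ! (length l + k) = r ! k"
    using assms by (cases k; simp add: nth_append)+
  obtain k' where k': "k = Suc k'" using assms by (cases k) auto
  have "interchange (length l + k) (l @ r) = l @ interchange k r"
    using assms unfolding interchange_def nth by (simp add: k' list_update_append)
  then show "hecke (length l + k) (prepend l (vtensor r)) = prepend l (hecke k (vtensor r))"
    by (simp only: hecke_vtensor nth op_simps prepend_vtensor if_distrib[of "prepend l"])
qed

lemma hecke_prepend_pair:
  "hecke (Suc 0) (prepend [x, y] v) =
    scale (stay x y) (prepend [x, y] v) + (if x = y then 0 else prepend [y, x] v)"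
proof (rule linear_op_eqI[where x = v and F = "\<lambda>v. hecke (Suc 0) (prepend [x, y] v)"
      and G = "\<lambda>v. scale (stay x y) (prepend [x, y] v) + (if x = y then 0 else prepend [y, x] v)",
      folded vtensor_def])
  show "linear_op (\<lambda>v. scale (stay x y) (prepend [x, y] v) + (if x = y then 0 else prepend [y, x] v))"
    by (cases "x = y") (simp_all add: linear_op_intros prepend_linear)
qed (simp_all add: linear_op_compose[OF hecke_linear] prepend_linear hecke_vtensor interchange_def)

lemma hecke_words:
  "hecke (Suc 0) (vtensor (x # y # r)) =
    scale (stay x y) (vtensor (x # y # r)) + (if x = y then 0 else vtensor (y # x # r))"
  "hecke 2 (vtensor (a # x # y # r)) =
    scale (stay x y) (vtensor (a # x # y # r)) + (if x = y then 0 else vtensor (a # y # x # r))"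
  "hecke 3 (vtensor (a # b # x # y # r)) =
    scale (stay x y) (vtensor (a # b # x # y # r)) + (if x = y then 0 else vtensor (a # b # y # x # r))"
  by (simp_all add: hecke_vtensor interchange_def numeral_eq_Suc)

lemma hecke_inv_words:
  "hecke_inv (Suc 0) (vtensor (x # y # r)) =
    scale (stay x y - (t - inverse t)) (vtensor (x # y # r)) + (if x = y then 0 else vtensor (y # x # r))"
  "hecke_inv 2 (vtensor (a # x # y # r)) =
    scale (stay x y - (t - inverse t)) (vtensor (a # x # y # r)) + (if x = y then 0 else vtensor (a # y # x # r))"
  by (simp_all add: hecke_inv_def hecke_words scale_distrib)

lemma word_split:
  assumes "1 \<le> k" "k < length a"
  obtains l x y r where "a = l @ x # y # r" "k = length l + 1"
proof
  have "drop (k - 1) a = a ! (k - 1) # drop k a" "drop k a = a ! k # drop (k + 1) a"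
    using assms Cons_nth_drop_Suc[of "k - 1" a] Cons_nth_drop_Suc[of k a] by simp_all
  then show "a = take (k - 1) a @ a ! (k - 1) # a ! k # drop (k + 1) a"
    by (metis append_take_drop_id)
  show "k = length (take (k - 1) a) + 1"
    using assms by simp
qed

lemma hecke_closed:
  assumes k: "1 \<le> k" "k < n" and v: "v \<in> tensor_power d n"
  shows "hecke k v \<in> tensor_power d n"
proof (rule linear_op_into_tensor_power[OF hecke_linear _ v])
  fix a assume a: "a \<in> tensor_indices d n"
  have "interchange k a \<in> tensor_indices d n"
    using a k by (auto simp: tensor_indices_def interchange_def
        dest!: set_update_subset_insert[THEN subsetD])
  with a show "hecke k (vtensor a) \<in> tensor_power d n"
    by (auto simp: hecke_vtensor intro!: tensor_power_closed vtensor_in_tensor_power)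
qed

lemma hecke_inv_closed:
  assumes k: "1 \<le> k" "k < n" and v: "v \<in> tensor_power d n"
  shows "hecke_inv k v \<in> tensor_power d n"
  unfolding hecke_inv_def using hecke_closed[OF assms] v by (simp add: tensor_power_closed)

lemma hecke_quadratic:
  assumes k: "1 \<le> k" "k < n" and v: "v \<in> tensor_power d n"
  shows "hecke k (hecke k v) = v + scale (t - inverse t) (hecke k v)"
proof (rule linear_op_eq_on_tensor_power[where F = "\<lambda>v. hecke k (hecke k v)"
      and G = "\<lambda>v. v + scale (t - inverse t) (hecke k v)", OF _ _ _ v])
  fix a assume "a \<in> tensor_indices d n"
  then have "k < length a" using k by (simp add: tensor_indices_def)
  then obtain l x y r where a: "a = l @ x # y # r" "k = length l + 1"
    using word_split k(1) by blast
  have "hecke (Suc 0) (hecke (Suc 0) (vtensor (x # y # r)))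
      = vtensor (x # y # r) + scale (t - inverse t) (hecke (Suc 0) (vtensor (x # y # r)))"
    by (cases x y rule: linorder_cases; rule poly_mapping_eqI)
      (simp_all add: hecke_words op_simps stay_def lookup_add lookup_minus field_simps)
  moreover have "hecke k (prepend l u) = prepend l (hecke (Suc 0) u)" for u
    using hecke_prepend[of "Suc 0" l u] a(2) by simp
  moreover have "(vtensor a :: nat list \<Rightarrow>\<^sub>0 'k) = prepend l (vtensor (x # y # r))"
    by (simp add: a)
  ultimately show "hecke k (hecke k (vtensor a)) = vtensor a + scale (t - inverse t) (hecke k (vtensor a))"
    by (simp only: op_simps)
qed (intro linear_op_intros linear_op_compose[OF hecke_linear] hecke_linear)+

lemma hecke_inverse:
  assumes k: "1 \<le> k" "k < n" and v: "v \<in> tensor_power d n"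
  shows "hecke_inv k (hecke k v) = v" and "hecke k (hecke_inv k v) = v"
  using hecke_quadratic[OF assms] by (simp_all add: hecke_inv_def op_simps)

lemma hecke_braid:
  assumes k: "1 \<le> k" "k + 1 < n" and v: "v \<in> tensor_power d n"
  shows "hecke k (hecke (k + 1) (hecke k v)) = hecke (k + 1) (hecke k (hecke (k + 1) v))"
proof (rule linear_op_eq_on_tensor_power[where F = "\<lambda>v. hecke k (hecke (k + 1) (hecke k v))"
      and G = "\<lambda>v. hecke (k + 1) (hecke k (hecke (k + 1) v))", OF _ _ _ v])
  fix a assume "a \<in> tensor_indices d n"
  then have len: "k + 1 < length a" using k by (simp add: tensor_indices_def)
  then obtain l x r' where a': "a = l @ x # r'" "k = length l + 1"
    using word_split k(1) by (metis add_lessD1)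
  with len obtain y z r where a: "a = l @ x # y # z # r"
    by (cases r'; cases "tl r'") auto
  have "hecke (Suc 0) (hecke 2 (hecke (Suc 0) (vtensor (x # y # z # r))))
      = hecke 2 (hecke (Suc 0) (hecke 2 (vtensor (x # y # z # r))))"
    by (cases x y rule: linorder_cases; cases y z rule: linorder_cases; cases x z rule: linorder_cases;
        rule poly_mapping_eqI)
      (simp_all add: hecke_words op_simps stay_def lookup_add lookup_minus field_simps)
  moreover have "hecke k (prepend l u) = prepend l (hecke (Suc 0) u)"
    "hecke (k + 1) (prepend l u) = prepend l (hecke 2 u)" for u
    using hecke_prepend[of "Suc 0" l u] hecke_prepend[of 2 l u] a'(2) by simp_all
  moreover have "(vtensor a :: nat list \<Rightarrow>\<^sub>0 'k) = prepend l (vtensor (x # y # z # r))"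
    by (simp add: a)
  ultimately show "hecke k (hecke (k + 1) (hecke k (vtensor a)))
      = hecke (k + 1) (hecke k (hecke (k + 1) (vtensor a)))"
    by (simp only:)
qed (intro linear_op_compose[OF hecke_linear] hecke_linear)+

lemma hecke_far_commute:
  assumes ij: "1 \<le> i" "i + 1 < j" "j < n" and v: "v \<in> tensor_power d n"
  shows "hecke i (hecke j v) = hecke j (hecke i v)"
proof (rule linear_op_eq_on_tensor_power[where F = "\<lambda>v. hecke i (hecke j v)"
      and G = "\<lambda>v. hecke j (hecke i v)", OF _ _ _ v])
  fix a assume "a \<in> tensor_indices d n"
  then have "i < length a" using ij by (simp add: tensor_indices_def)
  then obtain l x y r where a: "a = l @ x # y # r" "i = length l + 1"
    using word_split ij(1) by blast
  \<comment> \<open>Letter pairs at positions \<open>i\<close> and \<open>j\<close> are disjoint: after removal of the prefix \<open>l\<close>, one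
    operator acts on the two front letters and the other one behind them.\<close>
  define h where "h = j - length l - 2"
  have j: "j = length l + (2 + h)" "1 \<le> h" using ij a(2) by (simp_all add: h_def)
  have far: "hecke (2 + h) (prepend [p, s] u) = prepend [p, s] (hecke h u)" for p s u
    using hecke_prepend[of h "[p, s]"] j(2) by simp
  have front: "hecke (Suc 0) (hecke (2 + h) (prepend [x, y] (vtensor r)))
      = hecke (2 + h) (hecke (Suc 0) (prepend [x, y] (vtensor r)))"
    by (simp add: far hecke_prepend_pair op_simps del: prepend_vtensor add_2_eq_Suc)
  have i: "hecke i (prepend l u) = prepend l (hecke (Suc 0) u)" for u
    using hecke_prepend[of "Suc 0" l u] a(2) by simp
  have j: "hecke j (prepend l u) = prepend l (hecke (2 + h) u)" for u
    unfolding j(1) by (rule hecke_prepend) simp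
  have "(vtensor a :: nat list \<Rightarrow>\<^sub>0 'k) = prepend l (prepend [x, y] (vtensor r))"
    by (simp add: a)
  then show "hecke i (hecke j (vtensor a)) = hecke j (hecke i (vtensor a))"
    by (simp only: i j front)
qed (intro linear_op_compose[OF hecke_linear] hecke_linear)+

end

section \<open>Cups and caps\<close>

definition pair_index :: "nat \<Rightarrow> nat" where
  "pair_index x = (x + 1) div 2"

lemma pair_index_less: "pair_index x < pair_index y \<Longrightarrow> x < y"
  by (auto simp: pair_index_def)

lemma pair_index_letters:
  assumes "1 \<le> j"
  shows "pair_index x = j \<longleftrightarrow> x = 2 * j - 1 \<or> x = 2 * j"
  using assms by (auto simp: pair_index_def)

lemma pair_letters:
  assumes "1 \<le> (j :: nat)"
  obtains a b where "2 * j - 1 = a" "2 * j = b" "a < b" "pair_index a = j" "pair_index b = j"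
    "\<And>x. pair_index x = j \<Longrightarrow> x = a \<or> x = b"
  using assms pair_index_letters[of j] by auto

lemma pair_index_range:
  assumes "x \<in> {1..2 * m}"
  shows "pair_index x \<in> {1..m}"
  using assms by (auto simp: pair_index_def)

locale cups_caps = hecke_parameter t for t :: "'k::field" +
  fixes m :: nat

begin

text \<open>Tensoring with \<open>u\<^sub>j\<close> on the left.\<close>

definition arc :: "nat \<Rightarrow> (nat list \<Rightarrow>\<^sub>0 'k) \<Rightarrow> (nat list \<Rightarrow>\<^sub>0 'k)" where
  "arc j v = prepend [2 * j - 1, 2 * j] v - scale t (prepend [2 * j, 2 * j - 1] v)"

definition cup :: "(nat \<Rightarrow> 'k) \<Rightarrow> (nat list \<Rightarrow>\<^sub>0 'k) \<Rightarrow> (nat list \<Rightarrow>\<^sub>0 'k)" where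
  "cup w v = (\<Sum>j\<in>{1..m}. scale (w j) (arc j v))"

text \<open>The value of the cap with weights \<open>w\<close> on a word of two letters.\<close>

definition pairing :: "(nat \<Rightarrow> 'k) \<Rightarrow> nat \<Rightarrow> nat \<Rightarrow> 'k" where
  "pairing w x y = (if pair_index x = pair_index y \<and> pair_index x \<in> {1..m} \<and> x \<noteq> y
    then (if x < y then 1 else - t) * w (pair_index x) else 0)"

definition cap :: "(nat \<Rightarrow> 'k) \<Rightarrow> (nat list \<Rightarrow>\<^sub>0 'k) \<Rightarrow> (nat list \<Rightarrow>\<^sub>0 'k)" where
  "cap w = linear_ext (\<lambda>a. case a of x # y # r \<Rightarrow> scale (pairing w x y) (vtensor r) | _ \<Rightarrow> 0)"

lemma arc_linear: "linear_op (arc j)"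
  unfolding arc_def[abs_def] by (intro linear_op_intros prepend_linear)

lemma cup_linear: "linear_op (cup w)"
  unfolding cup_def[abs_def] by (intro linear_op_intros arc_linear)

lemma cap_linear: "linear_op (cap w)"
  unfolding cap_def by (rule linear_ext_linear)

lemmas cup_cap_simps = linear_op_simps[OF arc_linear] linear_op_simps[OF cup_linear]
  linear_op_simps[OF cap_linear] op_simps

lemma cap_vtensor [simp]: "cap w (vtensor (x # y # r)) = scale (pairing w x y) (vtensor r)"
  by (simp add: cap_def)

lemma arc_closed:
  assumes "j \<in> {1..m}" and "v \<in> tensor_power (2 * m) n"
  shows "arc j v \<in> tensor_power (2 * m) (n + 2)"
  by (rule linear_op_into_tensor_power[OF arc_linear _ assms(2)])
    (use assms(1) in \<open>auto simp: arc_def tensor_indices_def intro!: tensor_power_closed vtensor_in_tensor_power\<close>)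

lemma cup_closed:
  assumes "v \<in> tensor_power (2 * m) n"
  shows "cup w v \<in> tensor_power (2 * m) (n + 2)"
  unfolding cup_def by (intro tensor_power_sum tensor_power_closed(3) arc_closed assms)

lemma cap_closed:
  assumes "v \<in> tensor_power d (n + 2)"
  shows "cap w v \<in> tensor_power d n"
proof (rule linear_op_into_tensor_power[OF cap_linear _ assms])
  fix a assume a: "a \<in> tensor_indices d (n + 2)"
  then obtain x y r where "a = x # y # r"
    by (cases a; cases "tl a") (auto simp: tensor_indices_def)
  with a show "cap w (vtensor a) \<in> tensor_power d n"
    by (auto simp: tensor_indices_def intro!: tensor_power_closed vtensor_in_tensor_power)
qed

lemma cap_prepend: "cap w (prepend [x, y] v) = scale (pairing w x y) v"
  by (rule linear_op_eqI[where x = v, OF linear_op_compose[OF cap_linear prepend_linear]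
        linear_op_scaled[OF linear_op_ident], folded vtensor_def]) simp

lemma hecke_prepend_2:
  assumes "1 \<le> k"
  shows "hecke (k + 2) (prepend [x, y] v) = prepend [x, y] (hecke k v)"
  using hecke_prepend[OF assms, of "[x, y]" v] by (simp add: add.commute)

lemma hecke_cup:
  assumes "1 \<le> k"
  shows "hecke (k + 2) (cup w v) = cup w (hecke k v)"
  unfolding cup_def arc_def by (simp only: cup_cap_simps hecke_prepend_2[OF assms])

lemma hecke_cap:
  assumes k: "1 \<le> k" and v: "v \<in> tensor_power d (n + 2)"
  shows "cap w (hecke (k + 2) v) = hecke k (cap w v)"
proof (rule linear_op_eq_on_tensor_power[where F = "\<lambda>v. cap w (hecke (k + 2) v)"
      and G = "\<lambda>v. hecke k (cap w v)", OF _ _ _ v])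
  fix a assume "a \<in> tensor_indices d (n + 2)"
  then obtain x y r where a: "a = x # y # r"
    by (cases a; cases "tl a") (auto simp: tensor_indices_def)
  have "(vtensor a :: _ \<Rightarrow>\<^sub>0 'k) = prepend [x, y] (vtensor r)"
    by (simp add: a)
  then show "cap w (hecke (k + 2) (vtensor a)) = hecke k (cap w (vtensor a))"
    by (simp only: hecke_prepend_2[OF k] cap_prepend cup_cap_simps)
qed (intro linear_op_compose[OF cap_linear] linear_op_compose[OF hecke_linear] hecke_linear cap_linear)+

lemma hecke_arc:
  assumes "1 \<le> j"
  shows "hecke 1 (arc j v) = scale (- inverse t) (arc j v)"
proof -
  obtain a b where ab: "2 * j - 1 = a" "2 * j = b" "a < b"
    using pair_letters[OF assms] by metis
  show ?thesis
    unfolding arc_def ab(1,2) using ab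
    by (intro poly_mapping_eqI)
      (simp add: cup_cap_simps hecke_prepend_pair stay_def lookup_add lookup_minus field_simps)
qed

lemma hecke_1_cup: "hecke 1 (cup w v) = scale (- inverse t) (cup w v)"
  unfolding cup_def
  by (simp only: cup_cap_simps scale_sum scale_simps, rule sum.cong)
    (simp_all add: hecke_arc mult.commute del: One_nat_def)

lemma cap_hecke_1:
  assumes v: "v \<in> tensor_power d (n + 2)"
  shows "cap w (hecke 1 v) = scale (- inverse t) (cap w v)"
proof (rule linear_op_eq_on_tensor_power[where F = "\<lambda>v. cap w (hecke 1 v)"
      and G = "\<lambda>v. scale (- inverse t) (cap w v)", OF _ _ _ v])
  fix a assume "a \<in> tensor_indices d (n + 2)"
  then obtain x y r where a: "a = x # y # r"
    by (cases a; cases "tl a") (auto simp: tensor_indices_def)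
  show "cap w (hecke 1 (vtensor a)) = scale (- inverse t) (cap w (vtensor a))"
    unfolding a
    by (cases x y rule: linorder_cases; rule poly_mapping_eqI)
      (simp_all add: cup_cap_simps hecke_words stay_def pairing_def lookup_add field_simps)
qed (intro linear_op_scaled linear_op_compose[OF cap_linear] linear_op_compose[OF hecke_linear]
    hecke_linear cap_linear)+

lemma cap_cup: "cap w (cup w' v) = scale (\<Sum>j\<in>{1..m}. w j * w' j * (1 + t\<^sup>2)) v"
proof -
  have "cap w (arc j v) = scale (w j * (1 + t\<^sup>2)) v" if j: "j \<in> {1..m}" for j
  proof -
    obtain a b where ab: "2 * j - 1 = a" "2 * j = b" "a < b" "pair_index a = j" "pair_index b = j"
      using pair_letters[of j] j by (metis atLeastAtMost_iff)
    show ?thesis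
      unfolding arc_def ab(1,2) using ab j
      by (intro poly_mapping_eqI)
        (simp add: cup_cap_simps cap_prepend pairing_def lookup_minus algebra_simps power2_eq_square)
  qed
  then show ?thesis
    unfolding cup_def
    by (intro poly_mapping_eqI)
      (simp add: cup_cap_simps lookup_sum sum_distrib_left sum_distrib_right ac_simps)
qed

text \<open>The contribution of one arc to a loop that is crossed by a strand with letter \<open>c\<close>. Only the
  order of \<open>c\<close> relative to the pair \<open>j\<close> matters, and the two letters of the pair give the same
  value.\<close>

lemma cap_hecke_2_arc:
  assumes j: "j \<in> {1..m}"
  shows "cap w (hecke 2 (arc j (vtensor (c # r)))) = scale (w j *
    (if j < pair_index c then t ^ 3 - inverse t else if j = pair_index c then t ^ 3 else 0))
    (vtensor (c # r))"
proof -
  obtain a b where ab: "2 * j - 1 = a" "2 * j = b" "a < b" "pair_index a = j" "pair_index b = j"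
      "\<And>x. pair_index x = j \<Longrightarrow> x = a \<or> x = b"
    using pair_letters[of j] j by (metis atLeastAtMost_iff)
  note word = cup_cap_simps hecke_words stay_def pairing_def lookup_add lookup_minus
    field_simps power2_eq_square power3_eq_cube
  consider "j < pair_index c" | "c = a" | "c = b" | "pair_index c < j"
    using ab(6)[of c] by (meson linorder_cases)
  then show ?thesis
  proof cases
    case 1
    then have "a < c" "b < c" "pair_index c \<noteq> j"
      using ab pair_index_less by auto
    with 1 j ab show ?thesis unfolding arc_def ab(1,2)
      by (intro poly_mapping_eqI) (simp add: word)
  next
    case 4
    then have "c < a" "c < b" "pair_index c \<noteq> j"
      using ab pair_index_less by auto
    with 4 j ab show ?thesis unfolding arc_def ab(1,2)
      by (intro poly_mapping_eqI) (simp add: word)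
  qed (use j ab in \<open>unfold arc_def ab(1,2), intro poly_mapping_eqI, simp add: word\<close>)+
qed

section \<open>Moving two strands across a cup\<close>

text \<open>The right action of \<open>H\<^sub>2 H\<^sub>3 H\<^sub>1\<^bsup>-1\<^esup> H\<^sub>2\<^bsup>-1\<^esup>\<close>, a braid that moves the first two
  strands across the next two; in a right action the first factor is applied first.\<close>

definition transit :: "(nat list \<Rightarrow>\<^sub>0 'k) \<Rightarrow> (nat list \<Rightarrow>\<^sub>0 'k)" where
  "transit v = hecke_inv 2 (hecke_inv 1 (hecke 3 (hecke 2 v)))"

lemma transit_linear: "linear_op transit"
  unfolding transit_def[abs_def]
  by (intro linear_op_compose[OF hecke_inv_linear] linear_op_compose[OF hecke_linear] hecke_linear)

lemma transit_closed:
  assumes "v \<in> tensor_power d n" "4 \<le> n"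
  shows "transit v \<in> tensor_power d n"
  unfolding transit_def using assms by (intro hecke_inv_closed hecke_closed) auto

text \<open>The relation \<open>H\<^sub>3 G = G H\<^sub>1\<close>: conjugation by the braid carries a crossing of the last two
  strands to a crossing of the first two.\<close>

lemma transit_hecke_3:
  assumes v: "v \<in> tensor_power d n" and n: "4 \<le> n"
  shows "transit (hecke 3 v) = hecke 1 (transit v)"
proof -
  define y where "y = hecke 3 (hecke 2 v)"
  define u where "u = hecke_inv 2 (hecke_inv 1 y)"
  have y: "y \<in> tensor_power d n"
    unfolding y_def using v n by (intro hecke_closed) auto
  have u: "u \<in> tensor_power d n"
    unfolding u_def using y n by (intro hecke_inv_closed) auto
  have yu: "y = hecke 1 (hecke 2 u)"
    unfolding u_def using y n
    by (simp add: hecke_inverse(2)[where n = n and d = d] hecke_inv_closed del: One_nat_def)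
  \<comment> \<open>Written with \<open>u\<close>, the claim becomes two braid relations followed by cancellation of inverses.\<close>
  have "transit (hecke 3 v) = hecke_inv 2 (hecke_inv 1 (hecke 2 y))"
    unfolding transit_def y_def using hecke_braid[of 2 n v d] v n by (simp del: One_nat_def)
  also have "\<dots> = hecke_inv 2 (hecke_inv 1 (hecke 1 (hecke 2 (hecke 1 u))))"
    unfolding yu using hecke_braid[of 1 n u d] u n by (simp add: one_add_one del: One_nat_def)
  also have "\<dots> = hecke 1 u"
    using u n by (simp add: hecke_inverse(1)[where n = n and d = d] hecke_closed del: One_nat_def)
  finally show ?thesis
    by (simp add: u_def y_def transit_def)
qed

text \<open>If \<open>c < d\<close> form a pair, then the strands of the arc come out unharmed behind the
  strands \<open>c\<close>, \<open>d\<close>, which are the ones that the cap removes. All other words that arise are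
  killed by the cap or cancel.\<close>

lemma cap_transit_arc_of_pair:
  assumes j: "j \<in> {1..m}" and cd: "c < d" "pair_index c = pair_index d" "pair_index c \<in> {1..m}"
  shows "cap w (transit (arc j (vtensor (c # d # r)))) = scale (w (pair_index c)) (arc j (vtensor r))"
proof -
  obtain a b where ab: "2 * j - 1 = a" "2 * j = b" "a < b" "pair_index a = j" "pair_index b = j"
      "\<And>x. pair_index x = j \<Longrightarrow> x = a \<or> x = b"
    using pair_letters[of j] j by (metis atLeastAtMost_iff)
  note word = cup_cap_simps transit_def hecke_words hecke_inv_words stay_def pairing_def lookup_add lookup_minus
    field_simps power2_eq_square power3_eq_cube
  consider "j < pair_index c" | "c = a" "d = b" | "pair_index c < j"
    using ab cd by (metis linorder_neqE_nat less_irrefl less_asym)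
  then show ?thesis
  proof cases
    case 1
    then have "a < c" "b < c" "a < d" "b < d" "pair_index c \<noteq> j" "pair_index d \<noteq> j"
      using ab cd pair_index_less by auto
    with 1 j ab cd show ?thesis unfolding arc_def ab(1,2)
      by (intro poly_mapping_eqI) (simp add: word)
  next
    case 3
    then have "c < a" "c < b" "d < a" "d < b" "pair_index c \<noteq> j" "pair_index d \<noteq> j"
      using ab cd pair_index_less by auto
    with 3 j ab cd show ?thesis unfolding arc_def ab(1,2)
      by (intro poly_mapping_eqI) (simp add: word)
  qed (use j ab cd in \<open>unfold arc_def ab(1,2), intro poly_mapping_eqI, simp add: word\<close>)+
qed

text \<open>If \<open>c < d\<close> lie in different pairs, the cap can only remove the letters of the arc itself. What
  is left is a multiple of the word \<open>c d\<close>, and the multiple vanishes unless the arc lies between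
  the pairs of \<open>c\<close> and \<open>d\<close>, these two included. It is written so that the sum over all arcs telescopes.\<close>

lemma cap_transit_arc_of_nonpair:
  assumes j: "j \<in> {1..m}" and cd: "pair_index c < pair_index d"
  shows "cap w (transit (arc j (vtensor (c # d # r)))) = scale (w j * (1 - inverse t ^ 2) *
      ((if pair_index c \<le> j \<and> j < pair_index d then 1 else 0)
        - (if pair_index c < j \<and> j \<le> pair_index d then t ^ 4 else 0)))
    (vtensor (c # d # r))"
proof -
  obtain a b where ab: "2 * j - 1 = a" "2 * j = b" "a < b" "pair_index a = j" "pair_index b = j"
      "\<And>x. pair_index x = j \<Longrightarrow> x = a \<or> x = b"
    using pair_letters[of j] j by (metis atLeastAtMost_iff)
  have "c < d" using cd pair_index_less by auto
  note word = cup_cap_simps transit_def hecke_words hecke_inv_words stay_def pairing_def lookup_add lookup_minus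
    field_simps power2_eq_square power4_eq_xxxx
  consider "j < pair_index c" | "c = a" | "c = b" | "pair_index c < j" "j < pair_index d"
    | "d = a" | "d = b" | "pair_index d < j"
    using ab cd by (metis linorder_neqE_nat)
  then show ?thesis
  proof cases
    case 1
    then have "a < c" "b < c" "a < d" "b < d" "pair_index c \<noteq> j" "pair_index d \<noteq> j"
      using ab cd pair_index_less by auto
    with 1 j ab cd \<open>c < d\<close> show ?thesis unfolding arc_def ab(1,2)
      by (intro poly_mapping_eqI) (simp add: word)
  next
    case 2
    then have "a < d" "b < d" "pair_index d \<noteq> j"
      using ab cd pair_index_less by auto
    with 2 j ab cd \<open>c < d\<close> show ?thesis unfolding arc_def ab(1,2)
      by (intro poly_mapping_eqI) (simp add: word)
  next
    case 3
    then have "a < d" "b < d" "pair_index d \<noteq> j"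
      using ab cd pair_index_less by auto
    with 3 j ab cd \<open>c < d\<close> show ?thesis unfolding arc_def ab(1,2)
      by (intro poly_mapping_eqI) (simp add: word)
  next
    case 4
    then have "c < a" "c < b" "a < d" "b < d" "pair_index c \<noteq> j" "pair_index d \<noteq> j"
      using ab cd pair_index_less by auto
    with 4 j ab cd \<open>c < d\<close> show ?thesis unfolding arc_def ab(1,2)
      by (intro poly_mapping_eqI) (simp add: word)
  next
    case 5
    then have "c < a" "c < b" "pair_index c \<noteq> j"
      using ab cd pair_index_less by auto
    with 5 j ab cd \<open>c < d\<close> show ?thesis unfolding arc_def ab(1,2)
      by (intro poly_mapping_eqI) (simp add: word)
  next
    case 6
    then have "c < a" "c < b" "pair_index c \<noteq> j"
      using ab cd pair_index_less by auto
    with 6 j ab cd \<open>c < d\<close> show ?thesis unfolding arc_def ab(1,2)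
      by (intro poly_mapping_eqI) (simp add: word)
  next
    case 7
    then have "c < a" "c < b" "d < a" "d < b" "pair_index c \<noteq> j" "pair_index d \<noteq> j"
      using ab cd pair_index_less by auto
    with 7 j ab cd \<open>c < d\<close> show ?thesis unfolding arc_def ab(1,2)
      by (intro poly_mapping_eqI) (simp add: word)
  qed
qed

section \<open>Double cups and double caps\<close>

text \<open>The defects of \<open>u\<^sub>i \<otimes> u\<^sub>j\<close> and \<open>u\<^sub>j \<otimes> u\<^sub>i\<close> are opposite, not zero, so the two have to be added.
  For \<open>i < j\<close> the four letters are in a fixed order, so this is a single computation.\<close>

lemma arc_pair_exchange:
  assumes "1 \<le> i" "i < j"
  shows "hecke 1 (hecke 2 (arc i (arc j v) + arc j (arc i v)))
    = hecke 3 (hecke 2 (arc i (arc j v) + arc j (arc i v)))"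
proof (rule linear_op_eqI[where x = v and
      F = "\<lambda>v. hecke 1 (hecke 2 (arc i (arc j v) + arc j (arc i v)))" and
      G = "\<lambda>v. hecke 3 (hecke 2 (arc i (arc j v) + arc j (arc i v)))", folded vtensor_def])
  fix r
  obtain a b where ab: "2 * i - 1 = a" "2 * i = b" "a < b" "pair_index a = i" "pair_index b = i"
    using pair_letters[of i] assms by metis
  obtain c d where cd: "2 * j - 1 = c" "2 * j = d" "c < d" "pair_index c = j" "pair_index d = j"
    using pair_letters[of j] assms by (metis le_trans less_imp_le)
  have "b < c"
    using ab cd assms pair_index_less by metis
  with ab cd show "hecke 1 (hecke 2 (arc i (arc j (vtensor r)) + arc j (arc i (vtensor r))))
      = hecke 3 (hecke 2 (arc i (arc j (vtensor r)) + arc j (arc i (vtensor r))))"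
    unfolding arc_def ab(1,2) cd(1,2)
    by (intro poly_mapping_eqI)
      (simp add: cup_cap_simps hecke_words stay_def lookup_add lookup_minus field_simps)
qed (intro linear_op_compose[OF hecke_linear] linear_op_plus linear_op_compose[OF arc_linear] arc_linear)+

lemma arc_self_exchange:
  assumes "1 \<le> i"
  shows "hecke 1 (hecke 2 (arc i (arc i v))) = hecke 3 (hecke 2 (arc i (arc i v)))"
proof (rule linear_op_eqI[where x = v and
      F = "\<lambda>v. hecke 1 (hecke 2 (arc i (arc i v)))" and
      G = "\<lambda>v. hecke 3 (hecke 2 (arc i (arc i v)))", folded vtensor_def])
  fix r
  obtain a b where ab: "2 * i - 1 = a" "2 * i = b" "a < b" "pair_index a = i" "pair_index b = i"
    using pair_letters[of i] assms by metis
  then show "hecke 1 (hecke 2 (arc i (arc i (vtensor r)))) = hecke 3 (hecke 2 (arc i (arc i (vtensor r))))"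
    unfolding arc_def ab(1,2)
    by (intro poly_mapping_eqI)
      (simp add: cup_cap_simps hecke_words stay_def lookup_add lookup_minus field_simps)
qed (intro linear_op_compose[OF hecke_linear] linear_op_compose[OF arc_linear] arc_linear)+

lemma sum_alternating:
  fixes f :: "nat \<Rightarrow> nat \<Rightarrow> 'b::ab_group_add"
  assumes "\<And>i. i \<in> {1..n} \<Longrightarrow> f i i = 0"
    and "\<And>i j. 1 \<le> i \<Longrightarrow> i < j \<Longrightarrow> j \<le> n \<Longrightarrow> f i j + f j i = 0"
  shows "(\<Sum>i\<in>{1..n}. \<Sum>j\<in>{1..n}. f i j) = 0"
  using assms
proof (induction n)
  case (Suc n)
  have "(\<Sum>i\<in>{1..n}. f i (Suc n)) + (\<Sum>j\<in>{1..n}. f (Suc n) j) = 0"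
    unfolding sum.distrib[symmetric] by (rule sum.neutral) (use Suc.prems(2) in auto)
  moreover have "(\<Sum>i\<in>{1..n}. \<Sum>j\<in>{1..n}. f i j) = 0"
    by (rule Suc.IH) (use Suc.prems in auto)
  moreover have "f (Suc n) (Suc n) = 0"
    using Suc.prems(1) by simp
  ultimately show ?case
    by (simp add: sum.distrib ac_simps)
qed simp

lemma cup_cup_exchange:
  "hecke 1 (hecke 2 (cup w (cup w v))) = hecke 3 (hecke 2 (cup w (cup w v)))"
proof -
  \<comment> \<open>The pair of arcs \<open>i, j\<close> and the pair \<open>j, i\<close> have the same weight, so their defects cancel.\<close>
  define D where "D x = hecke 1 (hecke 2 x) - hecke 3 (hecke 2 x)" for x
  have D: "linear_op D"
    unfolding D_def[abs_def]
    by (intro linear_op_intros linear_op_compose[OF hecke_linear] hecke_linear)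
  have "D (cup w (cup w v)) = (\<Sum>i\<in>{1..m}. \<Sum>j\<in>{1..m}. scale (w i * w j) (D (arc i (arc j v))))"
    by (simp add: cup_def cup_cap_simps linear_op_simps[OF D] scale_sum)
  also have "\<dots> = 0"
  proof (rule sum_alternating)
    fix i j :: nat assume "1 \<le> i" "i < j"
    from arc_pair_exchange[OF this, of v]
    have "D (arc i (arc j v)) + D (arc j (arc i v)) = 0"
      by (simp add: D_def cup_cap_simps algebra_simps)
    then show "scale (w i * w j) (D (arc i (arc j v))) + scale (w j * w i) (D (arc j (arc i v))) = 0"
      by (metis mult.commute scale_distrib(1) scale_simps(1))
  qed (use arc_self_exchange in \<open>simp add: D_def\<close>)
  finally show ?thesis by (simp add: D_def)
qed

text \<open>The exchange law replaces \<open>H\<^sub>3\<close> by \<open>H\<^sub>1\<close> in \<open>H\<^sub>2 H\<^sub>3 H\<^sub>1\<^bsup>-1\<^esup> H\<^sub>2\<^bsup>-1\<^esup>\<close>, and everything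
  cancels.\<close>

lemma transit_cup_cup:
  assumes v: "v \<in> tensor_power (2 * m) n"
  shows "transit (cup w (cup w v)) = cup w (cup w v)"
proof -
  let ?U = "cup w (cup w v)"
  have U: "?U \<in> tensor_power (2 * m) (n + 2 + 2)"
    by (intro cup_closed v)
  show ?thesis
    unfolding transit_def cup_cup_exchange[symmetric] using U
    by (simp add: hecke_inverse(1)[where n = "n + 2 + 2" and d = "2 * m"] hecke_closed
        del: One_nat_def)
qed

text \<open>The bilinear form for which the words are an orthonormal basis. It turns statements about
  double cups into statements about double caps.\<close>

definition form :: "(nat list \<Rightarrow>\<^sub>0 'k) \<Rightarrow> (nat list \<Rightarrow>\<^sub>0 'k) \<Rightarrow> 'k" where
  "form x y = (\<Sum>a\<in>Poly_Mapping.keys x. Poly_Mapping.lookup x a * Poly_Mapping.lookup y a)"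

lemma form_vtensor_right: "form x (vtensor a) = Poly_Mapping.lookup x a"
  by (auto simp: form_def vtensor_def lookup_single when_def in_keys_iff if_distrib cong: if_cong)

lemma form_commute: "form x y = form y x"
proof -
  have "form u v = (\<Sum>a\<in>Poly_Mapping.keys u \<union> Poly_Mapping.keys v.
      Poly_Mapping.lookup u a * Poly_Mapping.lookup v a)" for u v
    unfolding form_def by (rule sum.mono_neutral_left) (auto simp: in_keys_iff)
  from this[of x y] this[of y x] show ?thesis
    by (simp add: Un_commute mult.commute)
qed

lemma form_adjoint:
  assumes F: "linear_op F" and G: "linear_op G"
    and x: "x \<in> tensor_power d n" and y: "y \<in> tensor_power d' n'"
    and basis: "\<And>a b. a \<in> tensor_indices d n \<Longrightarrow> b \<in> tensor_indices d' n' \<Longrightarrow>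
      Poly_Mapping.lookup (F (vtensor a)) b = Poly_Mapping.lookup (G (vtensor b)) a"
  shows "form (F x) y = form x (G y)"
proof -
  have expand: "L z = (\<Sum>a\<in>Poly_Mapping.keys z. scale (Poly_Mapping.lookup z a) (L (vtensor a)))"
    if "linear_op L" for L :: "(nat list \<Rightarrow>\<^sub>0 'k) \<Rightarrow> (nat list \<Rightarrow>\<^sub>0 'k)" and z
    by (subst (1) poly_mapping_expand[of z, symmetric])
      (simp add: linear_op_simps[OF that] vtensor_def)
  have "form (F x) y = (\<Sum>b\<in>Poly_Mapping.keys y. Poly_Mapping.lookup y b *
      (\<Sum>a\<in>Poly_Mapping.keys x. Poly_Mapping.lookup x a * Poly_Mapping.lookup (F (vtensor a)) b))"
    unfolding form_commute[of "F x"] form_def[of y] by (subst expand[OF F]) (simp add: lookup_sum)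
  also have "\<dots> = (\<Sum>b\<in>Poly_Mapping.keys y. Poly_Mapping.lookup y b *
      (\<Sum>a\<in>Poly_Mapping.keys x. Poly_Mapping.lookup x a * Poly_Mapping.lookup (G (vtensor b)) a))"
    using x y by (intro sum.cong refl arg_cong2[where f = "(*)"] basis)
      (auto simp: tensor_power_def)
  also have "\<dots> = (\<Sum>a\<in>Poly_Mapping.keys x. Poly_Mapping.lookup x a *
      (\<Sum>b\<in>Poly_Mapping.keys y. Poly_Mapping.lookup y b * Poly_Mapping.lookup (G (vtensor b)) a))"
    by (simp only: sum_distrib_left, subst sum.swap) (simp add: ac_simps)
  also have "\<dots> = form x (G y)"
    unfolding form_def[of x] by (subst (2) expand[OF G]) (simp add: lookup_sum)
  finally show ?thesis .
qed

text \<open>The matrix of \<open>H\<^sub>k\<close> is symmetric, because interchanging two letters is an involution.\<close>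

lemma form_hecke:
  assumes k: "1 \<le> k" "k < n" and x: "x \<in> tensor_power d n" and y: "y \<in> tensor_power d n"
  shows "form (hecke k x) y = form x (hecke k y)"
proof (rule form_adjoint[OF hecke_linear hecke_linear x y])
  fix a b assume "a \<in> tensor_indices d n" "b \<in> tensor_indices d n"
  then have len: "k < length a" "k < length b" using k by (auto simp: tensor_indices_def)
  have invol: "interchange k (interchange k c) = c"
    "interchange k c ! (k - 1) = c ! k" "interchange k c ! k = c ! (k - 1)"
    if c: "k < length c" for c :: "nat list"
  proof -
    obtain l x y r where "c = l @ x # y # r" "k = length l + 1"
      by (rule word_split[OF k(1) c])
    then show "interchange k (interchange k c) = c"
      "interchange k c ! (k - 1) = c ! k" "interchange k c ! k = c ! (k - 1)"
      by (simp_all add: interchange_def nth_append list_update_append)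
  qed
  show "Poly_Mapping.lookup (hecke k (vtensor a)) b = Poly_Mapping.lookup (hecke k (vtensor b)) a"
  proof (cases "interchange k a = b")
    case True
    with invol[OF len(1)] show ?thesis
      by (auto simp: hecke_vtensor lookup_add lookup_vtensor)
  next
    case False
    with invol(1)[OF len(2)] have "interchange k b \<noteq> a" by auto
    with False show ?thesis
      by (auto simp: hecke_vtensor lookup_add lookup_vtensor)
  qed
qed

text \<open>With the same weights, the cap is the transpose of the cup.\<close>

lemma form_cap:
  assumes x: "x \<in> tensor_power d (n + 2)" and y: "y \<in> tensor_power d n"
  shows "form (cap w x) y = form x (cup w y)"
proof (rule form_adjoint[OF cap_linear cup_linear x y])
  fix a r assume a: "a \<in> tensor_indices d (n + 2)"
  then obtain x y s where a: "a = x # y # s"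
    by (cases a; cases "tl a") (auto simp: tensor_indices_def)
  define \<epsilon> :: 'k where "\<epsilon> = (if r = s \<and> x \<noteq> y then if x < y then 1 else - t else 0)"
  have arc: "Poly_Mapping.lookup (arc j (vtensor r)) a =
      (if pair_index x = j \<and> pair_index y = j then \<epsilon> else 0)"
    if j: "j \<in> {1..m}" for j
  proof -
    obtain p p' where p: "2 * j - 1 = p" "2 * j = p'" "p < p'"
      by (rule pair_letters[of j]) (use j in auto)
    have letter: "pair_index z = j \<longleftrightarrow> z = p \<or> z = p'" for z
      unfolding p(1,2)[symmetric] using j by (intro pair_index_letters) simp
    have "Poly_Mapping.lookup (arc j (vtensor r)) a =
        (if p = x \<and> p' = y \<and> r = s then 1 else 0) - t * (if p' = x \<and> p = y \<and> r = s then 1 else 0)"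
      unfolding arc_def p(1) unfolding p(2) a by (simp add: lookup_minus lookup_vtensor)
    also have "\<dots> = (if pair_index x = j \<and> pair_index y = j then \<epsilon> else 0)"
      unfolding letter \<epsilon>_def using p(3) by auto
    finally show ?thesis .
  qed
  have "Poly_Mapping.lookup (cup w (vtensor r)) a = (\<Sum>j\<in>{1..m}. if j = pair_index x then
      w j * (if pair_index y = pair_index x then \<epsilon> else 0) else 0)"
    unfolding cup_def lookup_sum
  proof (rule sum.cong)
    fix j assume "j \<in> {1..m}"
    from arc[OF this] show "Poly_Mapping.lookup (scale (w j) (arc j (vtensor r))) a =
        (if j = pair_index x then w j * (if pair_index y = pair_index x then \<epsilon> else 0) else 0)"
      by (cases "pair_index x = j") simp_all
  qed simp
  also have "\<dots> = (if pair_index x \<in> {1..m} then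
      w (pair_index x) * (if pair_index y = pair_index x then \<epsilon> else 0) else 0)"
    by (rule sum.delta) simp
  also have "\<dots> = Poly_Mapping.lookup (cap w (vtensor a)) r"
    unfolding a cap_vtensor pairing_def \<epsilon>_def lookup_scale lookup_vtensor by simp
  finally show "Poly_Mapping.lookup (cap w (vtensor a)) r = Poly_Mapping.lookup (cup w (vtensor r)) a" ..
qed

lemma cap_cap_exchange:
  assumes v: "v \<in> tensor_power (2 * m) (n + 2 + 2)"
  shows "cap w (cap w (hecke 2 (hecke 1 v))) = cap w (cap w (hecke 2 (hecke 3 v)))"
proof -
  let ?V = "tensor_power (2 * m) (n + 2 + 2)"
  have h: "hecke k x \<in> ?V" if "k \<in> {1,2,3}" "x \<in> ?V" for k x
    using that by (elim insertE emptyE) (auto intro!: hecke_closed)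
  have adj: "form (hecke k x) y = form x (hecke k y)" if "k \<in> {1,2,3}" "x \<in> ?V" "y \<in> ?V" for k x y
    using that by (intro form_hecke[where n = "n + 2 + 2"]) auto
  \<comment> \<open>Transposing moves all operators onto two cups, in the opposite order.\<close>
  have "form (cap w (cap w (hecke 2 (hecke k v)))) (vtensor r)
      = form v (hecke k (hecke 2 (cup w (cup w (vtensor r)))))"
    if r: "r \<in> tensor_indices (2 * m) n" and k: "k \<in> {1, 3}" for r k
  proof -
    note r = vtensor_in_tensor_power[OF r, where 'a = 'k]
    have hk: "hecke k v \<in> ?V" "hecke 2 (hecke k v) \<in> ?V"
      using k h v by blast+
    have "form (cap w (cap w (hecke 2 (hecke k v)))) (vtensor r)
        = form (hecke 2 (hecke k v)) (cup w (cup w (vtensor r)))"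
      by (simp only: form_cap[OF cap_closed[OF hk(2)] r] form_cap[OF hk(2) cup_closed[OF r]])
    also have "\<dots> = form (hecke k v) (hecke 2 (cup w (cup w (vtensor r))))"
      by (rule adj) (use hk cup_closed[OF cup_closed[OF r]] in auto)
    also have "\<dots> = form v (hecke k (hecke 2 (cup w (cup w (vtensor r)))))"
      by (rule adj[OF _ v h]) (use k cup_closed[OF cup_closed[OF r]] in auto)
    finally show ?thesis .
  qed
  then have "Poly_Mapping.lookup (cap w (cap w (hecke 2 (hecke 1 v)))) r
      = Poly_Mapping.lookup (cap w (cap w (hecke 2 (hecke 3 v)))) r"
    if "r \<in> tensor_indices (2 * m) n" for r
    using that cup_cup_exchange by (simp add: form_vtensor_right)
  moreover have "Poly_Mapping.lookup (cap w (cap w (hecke 2 (hecke k v)))) r = 0"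
    if "r \<notin> tensor_indices (2 * m) n" and k: "k \<in> {1, 3}" for r k
  proof -
    have "cap w (cap w (hecke 2 (hecke k v))) \<in> tensor_power (2 * m) n"
      using k by (intro cap_closed h v) auto
    with that show ?thesis
      by (auto simp: tensor_power_def in_keys_iff)
  qed
  ultimately show ?thesis
    by (intro poly_mapping_eqI) (metis insertCI)
qed

lemma cap_cap_transit:
  assumes v: "v \<in> tensor_power (2 * m) (n + 2 + 2)"
  shows "cap w (cap w (transit v)) = cap w (cap w v)"
proof -
  let ?V = "tensor_power (2 * m) (n + 2 + 2)"
  let ?\<Phi> = "\<lambda>v. cap w (cap w v)"
  have h: "hecke k x \<in> ?V" "hecke_inv k x \<in> ?V" if "k \<in> {1,2,3}" "x \<in> ?V" for k x
    using that(1) hecke_closed[OF _ _ that(2), of k] hecke_inv_closed[OF _ _ that(2), of k] by auto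
  have inv: "hecke_inv k (hecke k x) = x" "hecke k (hecke_inv k x) = x" if "k \<in> {1,2,3}" "x \<in> ?V" for k x
    using that by (auto intro!: hecke_inverse[where n = "n + 2 + 2"])
  \<comment> \<open>Both outer generators act on a double cap by the same scalar, which extends the exchange
    law from \<open>hecke 2\<close> to its inverse.\<close>
  have "?\<Phi> (hecke 3 x) = ?\<Phi> (hecke 1 x)" if "x \<in> ?V" for x
    using hecke_cap[of 1 x "2 * m" "n + 2" w] that cap_hecke_1[OF that, of w]
      cap_hecke_1[OF cap_closed[OF that], of w w]
    by (simp add: cup_cap_simps numeral_3_eq_3)
  then have exchange: "?\<Phi> (hecke_inv 2 (hecke 3 x)) = ?\<Phi> (hecke_inv 2 (hecke 1 x))" if "x \<in> ?V" for x
    using cap_cap_exchange[OF that, of w] that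
    by (simp add: hecke_inv_def cup_cap_simps)
  have "hecke_inv 1 (hecke 3 x) = hecke 3 (hecke_inv 1 x)" if "x \<in> ?V" for x
    using hecke_far_commute[of 1 3 "n + 2 + 2" x "2 * m"] that by (simp add: hecke_inv_def op_simps)
  then have "?\<Phi> (transit v) = ?\<Phi> (hecke_inv 2 (hecke 3 (hecke_inv 1 (hecke 2 v))))"
    unfolding transit_def using h(1)[of 2 v] v by (simp only: insert_iff simp_thms)
  also have "\<dots> = ?\<Phi> (hecke_inv 2 (hecke 1 (hecke_inv 1 (hecke 2 v))))"
    using exchange h v by (simp only: insert_iff simp_thms)
  also have "\<dots> = ?\<Phi> v"
    using h(1)[of 2 v] inv v by (simp only: insert_iff simp_thms)
  finally show ?thesis .
qed

end

section \<open>Balanced weights\<close>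

text \<open>The weights of cup and cap enter the relations for \<open>e\<close> through the products \<open>\<beta>\<^sub>j \<alpha>\<^sub>j\<close>. The condition
  \<open>t ^ 4 \<noteq> 1\<close> means \<open>t\<^sup>2 \<noteq> 1\<close> and \<open>t\<^sup>2 \<noteq> - 1\<close>: the first makes the value of a loop meaningful, and
  the second separates the eigenvalues \<open>t\<close> and \<open>- 1 / t\<close> of the Hecke operators.\<close>

locale balanced_weights = cups_caps +
  fixes \<alpha> \<beta> :: "nat \<Rightarrow> 'a"
  assumes t_power4: "t ^ 4 \<noteq> 1"
    and weights: "j \<in> {1..m} \<Longrightarrow> \<beta> j * \<alpha> j = t powi (2 * int m + 1 - 4 * int j)"

begin

lemma weight_sum:
  assumes "n \<le> m"
  shows "(\<Sum>j\<in>{1..n}. \<beta> j * \<alpha> j * (t ^ 3 - inverse t)) = t ^ (2 * m) - t powi (2 * int m - 4 * int n)"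
  using assms
proof (induction n)
  case 0
  show ?case by (simp add: power_int_def nat_mult_distrib)
next
  case (Suc n)
  \<comment> \<open>Each term is the difference of consecutive values of \<open>t powi (2 * int m - 4 * int j)\<close>.\<close>
  have "\<beta> (Suc n) * \<alpha> (Suc n) * (t ^ 3 - inverse t)
      = t powi (2 * int m - 4 * int n) - t powi (2 * int m - 4 * int (Suc n))"
    using Suc.prems weights[of "Suc n"]
      power_int_add[of t "2 * int m + 1 - 4 * int (Suc n)" 3]
      power_int_add[of t "2 * int m + 1 - 4 * int (Suc n)" "-1"]
    by (simp add: algebra_simps power_int_minus)
  with Suc show ?case by simp
qed

lemma cap_cup_weight:
  "cap \<beta> (cup \<alpha> v) = scale ((t ^ (2 * m) - inverse (t ^ (2 * m))) / (t - inverse t)) v"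
proof -
  have nz: "t - inverse t \<noteq> 0"
    using t_power4 by (auto simp: field_simps power4_eq_xxxx)
  have "(1 + t\<^sup>2) * (t - inverse t) = t ^ 3 - inverse t"
    by (simp add: field_simps power2_eq_square power3_eq_cube)
  then have "(\<Sum>j\<in>{1..m}. \<beta> j * \<alpha> j * (1 + t\<^sup>2)) * (t - inverse t)
      = (\<Sum>j\<in>{1..m}. \<beta> j * \<alpha> j * (t ^ 3 - inverse t))"
    by (simp only: sum_distrib_right mult.assoc)
  also have "\<dots> = t ^ (2 * m) - inverse (t ^ (2 * m))"
    using weight_sum[of m] by (simp add: power_int_def nat_mult_distrib power_inverse)
  finally have "(\<Sum>j\<in>{1..m}. \<beta> j * \<alpha> j * (1 + t\<^sup>2)) = (t ^ (2 * m) - inverse (t ^ (2 * m))) / (t - inverse t)"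
    by (rule iffD2[OF nonzero_eq_divide_eq[OF nz]])
  then show ?thesis
    by (simp only: cap_cup)
qed

text \<open>For a letter in the pair \<open>i\<close>, the pairs below \<open>i\<close> contribute a telescoping sum, the pair \<open>i\<close>
  contributes the missing end term, and the pairs above \<open>i\<close> contribute nothing.\<close>

lemma cap_hecke_2_cup:
  assumes v: "v \<in> tensor_power (2 * m) (Suc n)"
  shows "cap \<beta> (hecke 2 (cup \<alpha> v)) = scale (t ^ (2 * m)) v"
proof (rule linear_op_eq_on_tensor_power[where F = "\<lambda>v. cap \<beta> (hecke 2 (cup \<alpha> v))"
      and G = "\<lambda>v. scale (t ^ (2 * m)) v", OF _ _ _ v])
  fix a assume "a \<in> tensor_indices (2 * m) (Suc n)"
  then obtain c r where a: "a = c # r" and c: "c \<in> {1..2 * m}"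
    by (cases a) (auto simp: tensor_indices_def)
  obtain i where i: "pair_index c = Suc i" "Suc i \<le> m"
    using pair_index_range[OF c] by (cases "pair_index c") auto
  let ?f = "\<lambda>j. \<beta> j * \<alpha> j * (if j < Suc i then t ^ 3 - inverse t else if j = Suc i then t ^ 3 else 0)"
  have "(\<Sum>j\<in>{1..m}. ?f j) = (\<Sum>j\<in>{1..Suc i}. ?f j)"
    using i by (intro sum.mono_neutral_right) auto
  also have "\<dots> = (\<Sum>j\<in>{1..i}. \<beta> j * \<alpha> j * (t ^ 3 - inverse t)) + \<beta> (Suc i) * \<alpha> (Suc i) * t ^ 3"
    by simp
  also have "\<dots> = t ^ (2 * m)"
    using weight_sum[of i] i weights[of "Suc i"]
      power_int_add[of t "2 * int m + 1 - 4 * int (Suc i)" 3]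
    by (simp add: algebra_simps)
  finally have sum: "(\<Sum>j\<in>{1..m}. ?f j) = t ^ (2 * m)" .
  have "cap \<beta> (hecke 2 (cup \<alpha> (vtensor (c # r)))) = (\<Sum>j\<in>{1..m}. scale (?f j) (vtensor (c # r)))"
    unfolding cup_def cup_cap_simps
    by (rule sum.cong) (simp_all add: cap_hecke_2_arc i(1) ac_simps)
  also have "\<dots> = scale (t ^ (2 * m)) (vtensor (c # r))"
    unfolding sum[symmetric] by (rule poly_mapping_eqI) (simp only: lookup_sum lookup_scale sum_distrib_right)
  finally show "cap \<beta> (hecke 2 (cup \<alpha> (vtensor a))) = scale (t ^ (2 * m)) (vtensor a)"
    unfolding a .
qed (intro linear_op_scaled linear_op_ident linear_op_compose[OF cap_linear]
    linear_op_compose[OF hecke_linear] cup_linear)+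

lemma cap_transit_cup_increasing:
  assumes cd: "c < d" "c \<in> {1..2 * m}" "d \<in> {1..2 * m}"
  shows "cap \<beta> (transit (cup \<alpha> (vtensor (c # d # r)))) = cup \<alpha> (cap \<beta> (vtensor (c # d # r)))"
proof -
  note simps = cup_cap_simps linear_op_simps[OF transit_linear]
  have range: "pair_index c \<in> {1..m}" "pair_index d \<in> {1..m}"
    using cd pair_index_range by blast+
  have "pair_index c \<le> pair_index d"
    using cd(1) by (simp add: pair_index_def div_le_mono)
  then consider "pair_index c = pair_index d" | "pair_index c < pair_index d"
    by linarith
  then show ?thesis
  proof cases
    case 1
    then show ?thesis
      unfolding cup_def simps using cd range
      by (simp add: cap_transit_arc_of_pair pairing_def simps mult.commute)
  next
    case 2
    let ?i = "pair_index c" and ?k = "pair_index d"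
    let ?g = "\<lambda>j. \<beta> j * \<alpha> j"
    \<comment> \<open>The local coefficients are a difference of indicator functions of the ranges \<open>i \<le> j < k\<close>
      and \<open>i < j \<le> k\<close>, and shifting \<open>j\<close> by one costs exactly the factor \<open>t ^ 4\<close>.\<close>
    have step: "?g (Suc j) * t ^ 4 = ?g j" if "j \<in> {?i..<?k}" for j
      using that range weights[of j] weights[of "Suc j"]
        power_int_add[of t "2 * int m + 1 - 4 * int (Suc j)" 4]
      by (simp add: algebra_simps)
    have "(\<Sum>j\<in>{1..m}. ?g j * (if ?i < j \<and> j \<le> ?k then t ^ 4 else 0)) = (\<Sum>j\<in>{Suc ?i..<Suc ?k}. ?g j * t ^ 4)"
      using range by (intro sum.mono_neutral_cong_right) auto
    also have "\<dots> = (\<Sum>j\<in>{?i..<?k}. ?g j)"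
      unfolding sum.shift_bounds_Suc_ivl by (rule sum.cong) (simp_all only: step)
    also have "\<dots> = (\<Sum>j\<in>{1..m}. ?g j * (if ?i \<le> j \<and> j < ?k then 1 else 0))"
      using range by (intro sum.mono_neutral_cong_left) auto
    finally have sum: "(\<Sum>j\<in>{1..m}. ?g j * ((if ?i \<le> j \<and> j < ?k then 1 else 0)
        - (if ?i < j \<and> j \<le> ?k then t ^ 4 else 0))) = 0"
      by (simp only: right_diff_distrib sum_subtractf diff_self)
    have "cap \<beta> (transit (cup \<alpha> (vtensor (c # d # r)))) =
      (\<Sum>j\<in>{1..m}. scale (?g j * ((if ?i \<le> j \<and> j < ?k then 1 else 0)
        - (if ?i < j \<and> j \<le> ?k then t ^ 4 else 0))) (scale (1 - inverse t ^ 2) (vtensor (c # d # r))))"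
      unfolding cup_def simps
      by (rule sum.cong)
        (simp_all only: cap_transit_arc_of_nonpair[OF _ 2] scale_simps mult.assoc mult.commute mult.left_commute)
    also have "\<dots> = scale (\<Sum>j\<in>{1..m}. ?g j * ((if ?i \<le> j \<and> j < ?k then 1 else 0)
        - (if ?i < j \<and> j \<le> ?k then t ^ 4 else 0))) (scale (1 - inverse t ^ 2) (vtensor (c # d # r)))"
      by (rule poly_mapping_eqI) (simp only: lookup_sum lookup_scale sum_distrib_right)
    also have "\<dots> = 0"
      by (simp only: sum scale_simps(2))
    finally show ?thesis
      using 2 by (simp add: pairing_def simps)
  qed
qed

text \<open>In terms of \<open>e\<close>, this says that \<open>e G e\<close> is the composite of \<open>e\<close> with a copy of \<open>e\<close> acting on the third
  and fourth tensor factors.\<close>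

lemma cap_transit_cup:
  assumes v: "v \<in> tensor_power (2 * m) (n + 2)"
  shows "cap \<beta> (transit (cup \<alpha> v)) = cup \<alpha> (cap \<beta> v)"
proof (rule linear_op_eq_on_tensor_power[where F = "\<lambda>v. cap \<beta> (transit (cup \<alpha> v))"
      and G = "\<lambda>v. cup \<alpha> (cap \<beta> v)", OF _ _ _ v])
  let ?V = "tensor_power (2 * m) (n + 2)"
  let ?F = "\<lambda>v. cap \<beta> (transit (cup \<alpha> v))" and ?G = "\<lambda>v. cup \<alpha> (cap \<beta> v)"
  note lin = cup_cap_simps linear_op_simps[OF transit_linear]
  \<comment> \<open>Both sides turn \<open>hecke 1\<close> into the scalar \<open>- 1 / t\<close>, so they are determined by the
    words that start with an ascent.\<close>
  have F: "?F (hecke 1 v) = scale (- inverse t) (?F v)" if "v \<in> ?V" for v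
  proof -
    have U: "cup \<alpha> v \<in> tensor_power (2 * m) (n + 2 + 2)"
      using that by (rule cup_closed)
    have "cup \<alpha> (hecke 1 v) = hecke 3 (cup \<alpha> v)"
      using hecke_cup[of 1 \<alpha> v] by (simp add: numeral_3_eq_3)
    with transit_hecke_3[OF U] cap_hecke_1[OF transit_closed[OF U], of \<beta>] show ?thesis
      by simp
  qed
  have G: "?G (hecke 1 v) = scale (- inverse t) (?G v)" if "v \<in> ?V" for v
    by (simp add: cap_hecke_1[OF that] lin del: One_nat_def)
  fix a assume a: "a \<in> tensor_indices (2 * m) (n + 2)"
  then obtain c d r where w: "a = c # d # r"
    by (cases a; cases "tl a") (auto simp: tensor_indices_def)
  have cd: "c \<in> {1..2 * m}" "d \<in> {1..2 * m}"
    using a by (auto simp: w tensor_indices_def)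
  note V = vtensor_in_tensor_power[OF a, where 'a = 'a, unfolded w]
  consider "c < d" | "c = d" | "d < c" by linarith
  then show "?F (vtensor a) = ?G (vtensor a)"
  proof cases
    case 1
    with cd show ?thesis unfolding w by (intro cap_transit_cup_increasing)
  next
    case 2
    \<comment> \<open>A repeated letter is an eigenvector of \<open>hecke 1\<close> for \<open>t\<close>, so both sides vanish on it.\<close>
    have "t \<noteq> - inverse t"
    proof
      assume "t = - inverse t"
      then have "t * t = t * - inverse t" by (rule arg_cong)
      also have "\<dots> = - 1" by simp
      finally have "t * t = - 1" .
      then have "t ^ 4 = 1" by (simp add: power4_eq_xxxx mult.assoc)
      with t_power4 show False by simp
    qed
    moreover have "hecke 1 (vtensor (c # d # r)) = scale t (vtensor (c # d # r))"
      using 2 by (simp add: hecke_words stay_def)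
    ultimately have zero: "L (vtensor (c # d # r)) = 0"
      if "linear_op L" "L (hecke 1 (vtensor (c # d # r))) = scale (- inverse t) (L (vtensor (c # d # r)))"
      for L :: "_ \<Rightarrow> nat list \<Rightarrow>\<^sub>0 'a"
      using that by (intro scale_eq_imp_zero[of t _ "- inverse t"]) (simp_all add: linear_op_scale)
    have "?F (vtensor (c # d # r)) = 0"
      by (rule zero[OF _ F[OF V]])
        (intro linear_op_compose[OF cap_linear] linear_op_compose[OF transit_linear] cup_linear)
    moreover have "?G (vtensor (c # d # r)) = 0"
      by (rule zero[OF _ G[OF V]]) (intro linear_op_compose[OF cup_linear] cap_linear)
    ultimately show ?thesis unfolding w by simp
  next
    case 3
    \<comment> \<open>A descent is carried to an ascent by \<open>hecke 1\<close>, and \<open>- 1 / t\<close> is invertible.\<close>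
    have "hecke 1 (vtensor (c # d # r)) = (vtensor (d # c # r) :: _ \<Rightarrow>\<^sub>0 'a)"
      using 3 by (simp add: hecke_words stay_def)
    moreover have "?F (vtensor (d # c # r)) = ?G (vtensor (d # c # r))"
      using 3 cd by (intro cap_transit_cup_increasing)
    ultimately have "scale (- inverse t) (?F (vtensor (c # d # r))) = scale (- inverse t) (?G (vtensor (c # d # r)))"
      using F[OF V] G[OF V] by simp
    then have "scale (- t) (scale (- inverse t) (?F (vtensor (c # d # r))))
        = scale (- t) (scale (- inverse t) (?G (vtensor (c # d # r))))"
      by simp
    then show ?thesis unfolding w by simp
  qed
qed (intro linear_op_compose[OF cap_linear] linear_op_compose[OF transit_linear] cup_linear
    linear_op_compose[OF cup_linear] cap_linear)+

section \<open>The q-Brauer algebra acts\<close>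

primrec brauer_op :: "brauer_gen \<Rightarrow> (nat list \<Rightarrow>\<^sub>0 'a) \<Rightarrow> (nat list \<Rightarrow>\<^sub>0 'a)" where
  "brauer_op (GenH k) = hecke k"
| "brauer_op GenE = (\<lambda>v. cup \<alpha> (cap \<beta> v))"

lemma brauer_op_linear: "linear_op (brauer_op g)"
  by (cases g) (simp_all add: hecke_linear linear_op_compose[OF cup_linear cap_linear])

lemma brauer_op_closed:
  assumes n: "2 \<le> n" and g: "g \<in> qBrauer_gens n" and v: "v \<in> tensor_power (2 * m) n"
  shows "brauer_op g v \<in> tensor_power (2 * m) n"
proof (cases g)
  case (GenH k)
  with g show ?thesis by (auto simp: qBrauer_gens_def intro!: hecke_closed v)
next
  case GenE
  have "v \<in> tensor_power (2 * m) (n - 2 + 2)"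
    using n v by (simp del: add_2_eq_Suc')
  from cup_closed[OF cap_closed[OF this]] show ?thesis
    using n by (simp add: GenE del: add_2_eq_Suc')
qed

lemma free_act_brauer [simp]:
  "free_act brauer_op v (f * g) = free_act brauer_op (free_act brauer_op v f) g"
  "free_act brauer_op v (f + g) = free_act brauer_op v f + free_act brauer_op v g"
  "free_act brauer_op v (f - g) = free_act brauer_op v f - free_act brauer_op v g"
  "free_act brauer_op v 0 = 0"
  "free_act brauer_op v (fH k) = hecke k v"
  "free_act brauer_op v fE = cup \<alpha> (cap \<beta> v)"
  "free_act brauer_op v (scalar c) = scale c v"
  "free_act brauer_op v (fHinv (- inverse t) k) = hecke_inv k v"
  by (simp_all add: free_act_mult[OF brauer_op_linear] linear_op_simps[OF free_act_linear_right]
      word_act_def zero_word_def fHinv_def hecke_inv_def)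

lemma brauer_relations:
  assumes n: "2 \<le> n" and rel: "(l, r) \<in> qBrauer_rels n (- inverse t) (t ^ (2 * m))"
    and v: "v \<in> tensor_power (2 * m) n"
  shows "free_act brauer_op v l = free_act brauer_op v r"
  using rel
  supply free_act_basic(1) [simp del]
proof cases
  case (quadratic i)
  from hecke_quadratic[OF quadratic(3,4) v] show ?thesis
    unfolding quadratic(1,2)
    by (intro poly_mapping_eqI) (simp add: op_simps lookup_add lookup_minus algebra_simps)
next
  case (braid i)
  from hecke_braid[OF braid(3,4) v] show ?thesis
    unfolding braid(1,2) by simp
next
  case (far_commute i j)
  then have "i + 1 < j \<or> j + 1 < i" by linarith
  with hecke_far_commute[of i j n v] hecke_far_commute[of j i n v] far_commute v show ?thesis
    by auto
next
  case e_square
  have "(t ^ (2 * m) - inverse (t ^ (2 * m))) / (- inverse t - inverse (- inverse t))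
      = (t ^ (2 * m) - inverse (t ^ (2 * m))) / (t - inverse t)"
    by (simp add: inverse_eq_divide)
  then show ?thesis
    unfolding e_square by (simp add: cap_cup_weight cup_cap_simps)
next
  case H1_e
  have v2: "v \<in> tensor_power (2 * m) (n - 2 + 2)"
    using n v by (simp del: add_2_eq_Suc')
  show ?thesis
    using cap_hecke_1[OF v2, of \<beta>] unfolding H1_e(1,2) by (simp add: cup_cap_simps)
next
  case e_H1
  show ?thesis
    using hecke_1_cup unfolding e_H1 by (simp add: cup_cap_simps)
next
  case e_H2_e
  then have "Suc (n - 3) + 2 = n" by linarith
  with v have v3: "v \<in> tensor_power (2 * m) (Suc (n - 3) + 2)"
    by (simp only:)
  show ?thesis
    using cap_hecke_2_cup[OF cap_closed[OF v3]] unfolding e_H2_e(1,2) by (simp add: cup_cap_simps)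
next
  case (H_e_commute i)
  then have i: "1 \<le> i - 2" "i - 2 + 2 = i" by simp_all
  have n': "n = n - 2 + 2" using n by simp
  show ?thesis
    using hecke_cap[OF i(1), of v "2 * m" "n - 2" \<beta>] hecke_cup[OF i(1), of \<alpha> "cap \<beta> v"] v
    unfolding H_e_commute(1,2) i(2) n'[symmetric] by simp
next
  case e2_left
  then have "n - 4 + 2 + 2 = n" and "4 \<le> n" by linarith+
  with v transit_closed[OF v] have v4: "v \<in> tensor_power (2 * m) (n - 4 + 2 + 2)"
    and T: "transit v \<in> tensor_power (2 * m) (n - 4 + 2 + 2)"
    by (simp_all only:)
  show ?thesis
    using cap_transit_cup[OF cap_closed[OF v4]] cap_transit_cup[OF cap_closed[OF T]] cap_cap_transit[OF v4]
    unfolding e2_left(1,2) by (simp add: fE2_def del: One_nat_def flip: transit_def)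
next
  case e2_right
  then have "n - 4 + 2 + 2 = n" by linarith
  with v have v4: "v \<in> tensor_power (2 * m) (n - 4 + 2 + 2)"
    by (simp only:)
  show ?thesis
    using cap_transit_cup[OF cap_closed[OF v4]] transit_cup_cup[OF cap_closed[OF cap_closed[OF v4]]]
    unfolding e2_right(1,2) by (simp add: fE2_def del: One_nat_def flip: transit_def)
qed

lemma brauer_right_action:
  assumes n: "2 \<le> n"
  shows "\<exists>act. right_action (qBrauer n (- inverse t) (t ^ (2 * m))) (tensor_power (2 * m) n) scale act \<and>
    (\<forall>v\<in>tensor_power (2 * m) n.
      (\<forall>k\<in>{1..<n}. act v (qBrauer_H n (- inverse t) (t ^ (2 * m)) k) = hecke k v) \<and>
      act v (qBrauer_e n (- inverse t) (t ^ (2 * m))) = cup \<alpha> (cap \<beta> v))"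
proof -
  obtain act where act:
      "right_action (qBrauer n (- inverse t) (t ^ (2 * m))) (tensor_power (2 * m) n) scale act"
      "\<And>v f. v \<in> tensor_power (2 * m) n \<Longrightarrow> f \<in> carrier (free_algebra (qBrauer_gens n)) \<Longrightarrow>
        act v (qBrauer_class n (- inverse t) (t ^ (2 * m)) f) = free_act brauer_op v f"
    using qBrauer_right_action[OF brauer_op_linear tensor_power_subspace brauer_op_closed[OF n]
        brauer_relations[OF n]] by blast
  have "(fH k :: brauer_gen word \<Rightarrow>\<^sub>0 'a) \<in> carrier (free_algebra (qBrauer_gens n))" if "k \<in> {1..<n}" for k
    using that by (intro generator_in_free_algebra) (simp add: qBrauer_gens_def)
  moreover have "(fE :: brauer_gen word \<Rightarrow>\<^sub>0 'a) \<in> carrier (free_algebra (qBrauer_gens n))"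
    by (intro generator_in_free_algebra) (simp add: qBrauer_gens_def)
  ultimately show ?thesis
    using act(1) by (intro exI[of _ act]) (simp add: act(2) qBrauer_H_def qBrauer_e_def del: free_act_basic)
qed

end

section \<open>The action over the field of rational functions\<close>

lemma q_nonzero: "q \<noteq> 0"
  by (simp add: q_def Zero_fract_def eq_fract)

lemma q_power_neq_1:
  assumes "0 < k"
  shows "q ^ k \<noteq> 1"
proof
  assume "q ^ k = 1"
  moreover have "q ^ k = Fract ([:0, 1:] ^ k) 1"
    unfolding q_def by (induction k) (simp_all add: One_fract_def)
  ultimately have "[:0, 1:] ^ k = (1 :: rat poly)"
    by (simp add: One_fract_def eq_fract)
  then have "degree ([:0, 1 :: rat:] ^ k) = 0" by simp
  with assms show False by (simp add: degree_power_eq)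
qed

theorem proposition5p3:
  fixes m n :: nat and \<sigma> :: "nat \<Rightarrow> ratfun"
  assumes "m \<ge> 1" and "n \<ge> 2"
    and "\<And>j. 1 \<le> j \<Longrightarrow> j \<le> m - 1 \<Longrightarrow> \<sigma> (2 * j) \<in> int_laurent \<and> \<sigma> (2 * j) \<noteq> 0"
  shows "\<exists>act. right_action (qBr m n) (tensor_power (2 * m) n) scale act \<and>
    (\<forall>a\<in>tensor_indices (2 * m) n.
      (\<forall>k\<in>{1..n - 1}. act (vtensor a) (qBr_H m n k) =
        (if a ! (k - 1) = a ! k then scale q (vtensor a)
         else if a ! (k - 1) > a ! k then vtensor (interchange k a)
         else vtensor (interchange k a) + scale (q - inverse q) (vtensor a))) \<and>
      (\<forall>i\<in>{1..m}. a ! 0 = 2 * i - 1 \<and> a ! 1 = 2 * i \<longrightarrow>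
        act (vtensor a) (qBr_e m n) =
          (\<Sum>j\<in>{1..m}. scale (\<kappa> \<sigma> i * inverse (\<kappa> \<sigma> j) * q powi (2 * int m + 1 - 3 * int i - int j))
            (vtensor ([2 * j - 1, 2 * j] @ drop 2 a)
              - scale q (vtensor ([2 * j, 2 * j - 1] @ drop 2 a))))) \<and>
      (\<forall>i\<in>{1..m}. a ! 0 = 2 * i \<and> a ! 1 = 2 * i - 1 \<longrightarrow>
        act (vtensor a) (qBr_e m n) =
          scale (- q) (act (vtensor (interchange 1 a)) (qBr_e m n))) \<and>
      ((\<nexists>i. i \<in> {1..m} \<and> ((a ! 0 = 2 * i - 1 \<and> a ! 1 = 2 * i) \<or>
                            (a ! 0 = 2 * i \<and> a ! 1 = 2 * i - 1)))
        \<longrightarrow> act (vtensor a) (qBr_e m n) = 0))"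
proof -
  define \<alpha> where "\<alpha> j = inverse (\<kappa> \<sigma> j) * q powi (2 * int m + 1 - int j)" for j
  define \<beta> where "\<beta> i = \<kappa> \<sigma> i * q powi (- 3 * int i)" for i
  \<comment> \<open>The coefficient of \<open>e\<close> is split into a factor for the pair that is removed and one for the
    pair that is created.\<close>
  have weight: "\<beta> i * \<alpha> j = \<kappa> \<sigma> i * inverse (\<kappa> \<sigma> j) * q powi (2 * int m + 1 - 3 * int i - int j)" for i j
    using power_int_add[of q "- 3 * int i" "2 * int m + 1 - int j"] q_nonzero
    by (simp add: \<alpha>_def \<beta>_def algebra_simps)
  have \<kappa>: "\<kappa> \<sigma> i \<noteq> 0" if "i \<in> {1..m}" for i
    unfolding \<kappa>_def by (subst prod_zero_iff) (use that assms(3) in fastforce)+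
  interpret balanced_weights q m \<alpha> \<beta>
  proof
    show "q \<noteq> 0" by (rule q_nonzero)
    show "q ^ 4 \<noteq> 1" by (rule q_power_neq_1) simp
    show "\<beta> j * \<alpha> j = q powi (2 * int m + 1 - 4 * int j)" if "j \<in> {1..m}" for j
      using \<kappa>[OF that] by (simp add: weight)
  qed
  obtain act where act: "right_action (qBr m n) (tensor_power (2 * m) n) scale act"
      "\<And>v k. v \<in> tensor_power (2 * m) n \<Longrightarrow> k \<in> {1..<n} \<Longrightarrow> act v (qBr_H m n k) = hecke k v"
      "\<And>v. v \<in> tensor_power (2 * m) n \<Longrightarrow> act v (qBr_e m n) = cup \<alpha> (cap \<beta> v)"
    using brauer_right_action[OF assms(2)] by blast
  show ?thesis
  proof (intro exI[of _ act] conjI ballI impI)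
    show "right_action (qBr m n) (tensor_power (2 * m) n) scale act" by (rule act)
  next
    fix a k assume a: "a \<in> tensor_indices (2 * m) n" and k: "k \<in> {1..n - 1}"
    show "act (vtensor a) (qBr_H m n k) =
        (if a ! (k - 1) = a ! k then scale q (vtensor a)
         else if a ! (k - 1) > a ! k then vtensor (interchange k a)
         else vtensor (interchange k a) + scale (q - inverse q) (vtensor a))"
      using k by (subst act(2)[OF vtensor_in_tensor_power[OF a]])
        (auto simp: hecke_vtensor stay_def)
  next
    fix a assume a: "a \<in> tensor_indices (2 * m) n"
    then obtain x y r where w: "a = x # y # r"
      using assms(2) by (cases a; cases "tl a") (auto simp: tensor_indices_def)
    have e: "act (vtensor a) (qBr_e m n) = scale (pairing \<beta> x y) (cup \<alpha> (vtensor r))"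
      using act(3)[OF vtensor_in_tensor_power[OF a]] by (simp add: w cup_cap_simps)
    {
      fix i assume i: "i \<in> {1..m}" and "a ! 0 = 2 * i - 1 \<and> a ! 1 = 2 * i"
      then have "pairing \<beta> x y = \<beta> i"
        by (auto simp: w pairing_def pair_index_def)
      then show "act (vtensor a) (qBr_e m n) =
          (\<Sum>j\<in>{1..m}. scale (\<kappa> \<sigma> i * inverse (\<kappa> \<sigma> j) * q powi (2 * int m + 1 - 3 * int i - int j))
            (vtensor ([2 * j - 1, 2 * j] @ drop 2 a)
              - scale q (vtensor ([2 * j, 2 * j - 1] @ drop 2 a))))"
        unfolding e by (simp add: cup_def arc_def w scale_sum flip: weight)
    next
      fix i assume i: "i \<in> {1..m}" and xyi: "a ! 0 = 2 * i \<and> a ! 1 = 2 * i - 1"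
      have "interchange 1 a = y # x # r"
        by (simp add: w interchange_def)
      moreover have "y # x # r \<in> tensor_indices (2 * m) n"
        using a by (auto simp: w tensor_indices_def)
      ultimately have "act (vtensor (interchange 1 a)) (qBr_e m n) = scale (pairing \<beta> y x) (cup \<alpha> (vtensor r))"
        by (simp add: act(3)[OF vtensor_in_tensor_power] cup_cap_simps del: One_nat_def)
      moreover have "pairing \<beta> x y = - q * pairing \<beta> y x"
        using xyi i by (auto simp: w pairing_def pair_index_def)
      ultimately show "act (vtensor a) (qBr_e m n) = scale (- q) (act (vtensor (interchange 1 a)) (qBr_e m n))"
        unfolding e by simp
    next
      assume no_pair: "\<nexists>i. i \<in> {1..m} \<and> ((a ! 0 = 2 * i - 1 \<and> a ! 1 = 2 * i) \<or>
                            (a ! 0 = 2 * i \<and> a ! 1 = 2 * i - 1))"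
      have "pairing \<beta> x y = 0"
      proof (rule ccontr)
        assume "pairing \<beta> x y \<noteq> 0"
        then have p: "pair_index x = pair_index y" "pair_index x \<in> {1..m}" "x \<noteq> y"
          by (auto simp: pairing_def split: if_splits)
        with no_pair pair_index_letters[of "pair_index x" x] pair_index_letters[of "pair_index x" y]
        show False by (auto simp: w)
      qed
      then show "act (vtensor a) (qBr_e m n) = 0" unfolding e by simp
    }
  qed
qed

end
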